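(* Let $\mathcal{G}$ be a subdivision-closed class of (finite, unweighted) graphs. Then $\mathcal{G}$ has bounded (i.e. finite) Assouad--Nagata dimension if and only if there is a graph $H$ such that every graph in $\mathcal{G}$ is $H$-minor-free.
   Context: $\mathcal{G}$ is subdivision-closed if every subdivision (replacing edges by paths) of a member of $\mathcal{G}$ is in $\mathcal{G}$. Unweighted graphs are viewed as weighted graphs with every edge of weight $1$, with shortest-path distance $\mathrm{dist}_G$. For $S\subseteq V(G)$, $\mathrm{wdiam}_G(S)=\max_{u,v\in S}\mathrm{dist}_G(u,v)$. For real $r>0$, an $r$-path in $G$ is a sequence of vertices in which consecutive vertices are at distance at most $r$ in $G$. A map $c:V(G)\to C$ with $|C|=m$ is an $(m,r,d)$-colouring if every $r$-path all of whose vertices have the same colour has weak diameter in $G$ at most $d$. $f:\mathbb{R}^+\to\mathbb{R}^+$ is an $n$-dimensional control function for $G$ (resp. for a class) if $G$ (resp. every member) admits an $(n+1,r,f(r))$-colouring for every $r>0$. $f$ is a dilation if $f(r)\leq cr$ for some $c>0$ and all $r>0$. The Assouad--Nagata dimension of a class is the least $n\geq0$ such that the class admits an $n$-dimensional control function that is a dilation, and $\infty$ if none exists. *)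

theory Defs
  imports "Graph_Theory.Graph_Theory" "HOL-Library.Extended_Nat"
begin

text \<open>
  Finite simple graphs are the irreflexive symmetric digraphs of locale \<open>pair_graph\<close>.
  Every finite graph has an isomorphic copy on vertices of type \<open>nat\<close>, so a class of finite
  graphs is given as a set of graphs of type \<open>nat pair_pre_digraph\<close>. Such a set is not
  required to be closed under isomorphism.
\<close>

definition graph_class :: "nat pair_pre_digraph set \<Rightarrow> bool" where
  "graph_class \<G> \<longleftrightarrow> (\<forall>G\<in>\<G>. pair_graph G)"

definition subdivision_closed :: "nat pair_pre_digraph set \<Rightarrow> bool" where
  "subdivision_closed \<G> \<longleftrightarrow> (\<forall>G\<in>\<G>. \<forall>G'. subdivision_pair G G' \<longrightarrow> G' \<in> \<G>)"

text \<open>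
  \<open>H\<close> is a minor of \<open>G\<close> if \<open>G\<close> contains a model of \<open>H\<close>: pairwise disjoint branch sets
  \<open>B x\<close>, each inducing a connected (hence nonempty) subgraph of \<open>G\<close>, with an edge of \<open>G\<close> between
  \<open>B x\<close> and \<open>B y\<close> for every edge \<open>xy\<close> of \<open>H\<close>.
\<close>

definition is_minor :: "'a pair_pre_digraph \<Rightarrow> 'b pair_pre_digraph \<Rightarrow> bool" where
  "is_minor H G \<longleftrightarrow> (\<exists>B :: 'a \<Rightarrow> 'b set.
      (\<forall>x\<in>pverts H. B x \<subseteq> pverts G \<and>
          Digraph_Component.connected (induce_subgraph (with_proj G) (B x))) \<and>
      (\<forall>x\<in>pverts H. \<forall>y\<in>pverts H. x \<noteq> y \<longrightarrow> B x \<inter> B y = {}) \<and>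
      (\<forall>(x, y)\<in>parcs H. \<exists>u\<in>B x. \<exists>v\<in>B y. (u, v) \<in> parcs G))"

definition minor_free :: "'a pair_pre_digraph \<Rightarrow> 'b pair_pre_digraph \<Rightarrow> bool" where
  "minor_free H G \<longleftrightarrow> \<not> is_minor H G"

text \<open>Vertices in different components are at distance \<open>\<infinity>\<close>.\<close>

definition graph_dist :: "'a pair_pre_digraph \<Rightarrow> 'a \<Rightarrow> 'a \<Rightarrow> ereal" where
  "graph_dist G u v = wf_digraph.\<mu> (with_proj G) (\<lambda>_. 1) u v"

definition weak_diam :: "'a pair_pre_digraph \<Rightarrow> 'a set \<Rightarrow> ereal" where
  "weak_diam G S = (SUP u\<in>S. SUP v\<in>S. graph_dist G u v)"

definition r_path :: "'a pair_pre_digraph \<Rightarrow> real \<Rightarrow> 'a list \<Rightarrow> bool" where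
  "r_path G r p \<longleftrightarrow> p \<noteq> [] \<and> set p \<subseteq> pverts G \<and>
     successively (\<lambda>u v. graph_dist G u v \<le> ereal r) p"

definition is_colouring ::
  "'a pair_pre_digraph \<Rightarrow> nat \<Rightarrow> real \<Rightarrow> real \<Rightarrow> 'c set \<Rightarrow> ('a \<Rightarrow> 'c) \<Rightarrow> bool" where
  "is_colouring G m r d C c \<longleftrightarrow> finite C \<and> card C = m \<and> c ` pverts G \<subseteq> C \<and>
     (\<forall>p. r_path G r p \<and> (\<exists>k. \<forall>v\<in>set p. c v = k) \<longrightarrow> weak_diam G (set p) \<le> ereal d)"

text \<open>
  Functions from the positive reals to the positive reals are total functions on \<open>real\<close> whose
  values at nonpositive arguments are irrelevant.
\<close>

definition control_function :: "nat \<Rightarrow> (real \<Rightarrow> real) \<Rightarrow> 'a pair_pre_digraph \<Rightarrow> bool" where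
  "control_function n f G \<longleftrightarrow> (\<forall>r>0. f r > 0) \<and>
     (\<forall>r>0. \<exists>(C :: nat set) c. is_colouring G (n + 1) r (f r) C c)"

definition class_control_function ::
  "nat \<Rightarrow> (real \<Rightarrow> real) \<Rightarrow> 'a pair_pre_digraph set \<Rightarrow> bool" where
  "class_control_function n f \<G> \<longleftrightarrow> (\<forall>r>0. f r > 0) \<and> (\<forall>G\<in>\<G>. control_function n f G)"

definition dilation :: "(real \<Rightarrow> real) \<Rightarrow> bool" where
  "dilation f \<longleftrightarrow> (\<exists>c>0. \<forall>r>0. f r \<le> c * r)"

text \<open>The infimum of the empty set is \<open>\<infinity>\<close>.\<close>

definition assouad_nagata_dim :: "'a pair_pre_digraph set \<Rightarrow> enat" where
  "assouad_nagata_dim \<G> =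
     Inf {enat n | n. \<exists>f. class_control_function n f \<G> \<and> dilation f}"

end

theory Submission
  imports Defs "HOL-Analysis.Brouwer_Fixpoint"
begin

text \<open>
  Excluding a minor bounds the dimension, by an argument of Klein, Plotkin and Rao. Starting from a
  component of \<open>G\<close>, repeatedly choose a root, cut the current piece into layers according to the
  distance from the root within the piece, and keep a component of three consecutive layers.
  Colouring a vertex by the parities of its layers in \<open>t\<close> rounds, a monochromatic \<open>r\<close>-path stays in
  one piece in every round. If it had large weak diameter, it would contain \<open>t\<close> vertices
  \<open>w\<^sub>j\<close> that are far apart in \<open>G\<close>. The ball \<open>A\<^sub>k\<close> around the root of round \<open>k\<close> lying below the
  retained layers and a ball \<open>B\<^sub>j\<close> around \<open>w\<^sub>j\<close> in the last piece are all disjoint, and each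
  \<open>A\<^sub>k\<close> is adjacent to each \<open>B\<^sub>j\<close>, so the sets \<open>A\<^sub>j \<union> B\<^sub>j\<close> form a model of the complete graph
  on \<open>t\<close> vertices.

  Conversely, let the class contain a graph \<open>G\<close> with an \<open>(n+1)\<close>-dimensional king grid of side \<open>p\<close>
  as a minor. Subdivide \<open>G\<close> so that edges inside a branch set keep length \<open>1\<close>, edges between
  adjacent branch sets get length \<open>L = |V(G)|\<close> and all others get length \<open>Lp\<close>. The grid scaled by
  \<open>L\<close> then embeds with distortion at most \<open>3\<close>, and by Kuhn's combinatorial lemma any \<open>n+1\<close> colours
  leave a monochromatic king-connected set joining two opposite faces. Its weak diameter is at least
  \<open>Lp\<close>, while a control function \<open>r \<mapsto> cr\<close> applied at \<open>r = 3L\<close> would bound it by \<open>3cL\<close>.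
\<close>

subsection \<open>Walks and layers\<close>

text \<open>Layers are cut by distance inside the current piece while separation is measured in all
  of \<open>V\<close>, so the set that walks may use is a parameter. As \<open>refl\<close> holds
  for every \<open>n\<close>, the number is an upper bound on the length.\<close>

inductive walk_le :: "'a rel \<Rightarrow> 'a set \<Rightarrow> nat \<Rightarrow> 'a \<Rightarrow> 'a \<Rightarrow> bool" for E X where
  refl: "x \<in> X \<Longrightarrow> walk_le E X n x x"
| step: "walk_le E X n x y \<Longrightarrow> (y, z) \<in> E \<Longrightarrow> z \<in> X \<Longrightarrow> walk_le E X (Suc n) x z"

lemma walk_le_in:
  assumes "walk_le E X n u v" shows "u \<in> X" "v \<in> X"
  using assms by (induction) auto

lemma walk_le_0_iff: "walk_le E X 0 u v \<longleftrightarrow> u = v \<and> u \<in> X"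
  by (auto intro: walk_le.refl elim: walk_le.cases)

lemma walk_le_mono_length: "walk_le E X n u v \<Longrightarrow> n \<le> m \<Longrightarrow> walk_le E X m u v"
proof (induction arbitrary: m rule: walk_le.induct)
  case (step n x y z)
  then obtain m' where "m = Suc m'" "n \<le> m'" by (cases m) auto
  then show ?case using step by (auto intro: walk_le.step)
qed (auto intro: walk_le.refl)

lemma walk_le_mono: "walk_le E X n u v \<Longrightarrow> X \<subseteq> Y \<Longrightarrow> walk_le E Y n u v"
  by (induction rule: walk_le.induct) (auto intro: walk_le.intros)

lemma walk_le_trans:
  assumes "walk_le E X n u v" "walk_le E X m v w" shows "walk_le E X (n + m) u w"
  using assms(2,1)
  by (induction rule: walk_le.induct) (auto intro: walk_le.step walk_le_mono_length)

lemma walk_le_edge: "(u, v) \<in> E \<Longrightarrow> u \<in> X \<Longrightarrow> v \<in> X \<Longrightarrow> walk_le E X (Suc n) u v"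
  by (rule walk_le.step[OF walk_le.refl])

lemma walk_le_sym:
  assumes "sym E" "walk_le E X n u v" shows "walk_le E X n v u"
  using assms(2)
proof induction
  case (step n x y z)
  have "walk_le E X (Suc 0) z y"
    using step assms(1) by (auto intro!: walk_le_edge dest: walk_le_in symD)
  from walk_le_trans[OF this step.IH] show ?case by simp
qed (rule walk_le.refl)

text \<open>Each prefix of the walk is itself a walk of length at most \<open>n\<close>, so every
  vertex on the way is one of the \<open>z\<close> assumed to lie in \<open>Y\<close>.\<close>

lemma walk_le_restrict:
  assumes "walk_le E X n u v" "\<And>z. walk_le E X n u z \<Longrightarrow> z \<in> Y"
  shows "walk_le E Y n u v"
  using assms
proof (induction rule: walk_le.induct)
  case (step n x y z)
  have "walk_le E Y n x y"
    using step by (meson le_SucI order_refl walk_le_mono_length)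
  then show ?case
    using step by (meson walk_le.step)
qed (auto intro: walk_le.refl)

text \<open>An unspecified number if no walk inside \<open>X\<close> joins \<open>x\<close> to \<open>v\<close>.\<close>

definition level :: "'a rel \<Rightarrow> 'a set \<Rightarrow> 'a \<Rightarrow> 'a \<Rightarrow> nat" where
  "level E X x v = (LEAST n. walk_le E X n x v)"

definition component :: "'a rel \<Rightarrow> 'a set \<Rightarrow> 'a \<Rightarrow> 'a set" where
  "component E X v = {u. \<exists>n. walk_le E X n v u}"

lemma level_le: "walk_le E X n x v \<Longrightarrow> level E X x v \<le> n"
  unfolding level_def by (rule Least_le)

lemma walk_le_level: "walk_le E X n x v \<Longrightarrow> walk_le E X (level E X x v) x v"
  unfolding level_def by (rule LeastI)

lemma level_triangle:
  assumes "walk_le E X m x u" "walk_le E X n u v"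
  shows "level E X x v \<le> level E X x u + n"
  using assms by (blast intro: level_le walk_le_trans walk_le_level)

lemma level_diff:
  assumes "sym E" "walk_le E X m x u" "walk_le E X n u v"
  shows "level E X x u \<le> level E X x v + n" "level E X x v \<le> level E X x u + n"
  using level_triangle[OF walk_le_trans[OF assms(2,3)] walk_le_sym[OF assms(1,3)]]
    level_triangle[OF assms(2,3)] by auto

lemma component_subset: "component E X v \<subseteq> X"
  by (auto simp: component_def dest: walk_le_in)

lemma self_in_component: "v \<in> X \<Longrightarrow> v \<in> component E X v"
  by (auto simp: component_def intro: walk_le.refl)

lemma walk_le_component:
  assumes "walk_le E X n v u" shows "walk_le E (component E X v) n v u"
  using assms by (rule walk_le_restrict) (auto simp: component_def)

lemma component_connected:
  assumes "sym E" "a \<in> component E X v" "b \<in> component E X v"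
  shows "\<exists>n. walk_le E (component E X v) n a b"
proof -
  obtain m n where "walk_le E X m v a" "walk_le E X n v b"
    using assms by (auto simp: component_def)
  then have "walk_le E (component E X v) (m + n) a b"
    by (rule walk_le_trans[OF walk_le_sym[OF assms(1) walk_le_component] walk_le_component])
  then show ?thesis ..
qed

lemma component_eq:
  assumes "sym E" "walk_le E X n u v" shows "component E X u = component E X v"
proof -
  have "component E X v \<subseteq> component E X u" if "walk_le E X n u v" for u v
    using walk_le_trans[OF that] by (auto simp: component_def)
  from this[OF assms(2)] this[OF walk_le_sym[OF assms]] show ?thesis by blast
qed

text \<open>Followed backwards from \<open>v\<close>, a shortest walk lowers the level by exactly
  one per edge. Its confinement to the levels passed later keeps it inside a slab.\<close>

lemma level_descent:
  assumes "sym E" "walk_le E X m x v" "a + d = level E X x v"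
  shows "\<exists>z. level E X x z = a \<and>
    walk_le E {u \<in> X. a \<le> level E X x u \<and> level E X x u \<le> level E X x v} d v z"
  using assms(2,3)
proof (induction d arbitrary: v m)
  case 0
  then show ?case by (auto intro!: walk_le.refl exI[of _ v] dest: walk_le_in)
next
  case (Suc d)
  let ?l = "level E X x"
  have lv: "?l v = Suc (a + d)" using Suc.prems by simp
  have "walk_le E X (Suc (a + d)) x v"
    using walk_le_level[OF Suc.prems(1)] lv by simp
  then obtain y where y: "walk_le E X (a + d) x y" "(y, v) \<in> E" "v \<in> X"
  proof (cases rule: walk_le.cases)
    case refl
    then have "?l v = 0" using level_le[of E X 0 x v] walk_le.refl[of x X E 0] by simp
    then show ?thesis using lv by simp
  qed (use that in auto)
  have "?l y = a + d"
    using level_le[OF y(1)] level_triangle[OF y(1) walk_le_edge[OF y(2) walk_le_in(2)[OF y(1)] y(3)], of 0] lv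
    by simp
  moreover obtain z where z: "?l z = a"
    "walk_le E {u \<in> X. a \<le> ?l u \<and> ?l u \<le> ?l y} d y z"
    using Suc.IH[OF y(1)] \<open>?l y = a + d\<close> by auto
  have "walk_le E {u \<in> X. a \<le> ?l u \<and> ?l u \<le> ?l v} d y z"
    by (rule walk_le_mono[OF z(2)]) (use lv \<open>?l y = a + d\<close> in auto)
  moreover have "walk_le E {u \<in> X. a \<le> ?l u \<and> ?l u \<le> ?l v} (Suc 0) v y"
    using y lv \<open>?l y = a + d\<close> walk_le_in[OF y(1)] assms(1)
    by (intro walk_le_edge) (auto dest: symD)
  ultimately have "walk_le E {u \<in> X. a \<le> ?l u \<and> ?l u \<le> ?l v} (Suc 0 + d) v z"
    by (blast intro: walk_le_trans)
  then show ?case using z(1) by auto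
qed

text \<open>A shortest walk from \<open>x\<close> never rises above the level of its end. This makes
  the ball below a slab connected.\<close>

lemma walk_le_below_level:
  assumes "walk_le E X m x v" "level E X x v < a"
  shows "walk_le E {u \<in> X. level E X x u < a} (level E X x v) x v"
  using walk_le_level[OF assms(1)]
  by (rule walk_le_restrict) (use assms(2) in \<open>auto dest: walk_le_in intro: le_less_trans[OF level_le]\<close>)

section \<open>Distance and connectedness in terms of bounded walks\<close>

lemma walk_le_iff_awalk:
  assumes "pair_graph G" "u \<in> pverts G"
  shows "walk_le (parcs G) (pverts G) n u v \<longleftrightarrow>
    (\<exists>p. pre_digraph.awalk (with_proj G) u p v \<and> length p \<le> n)"
proof -
  interpret pair_graph G by fact
  show ?thesis
  proof
    assume "walk_le (parcs G) (pverts G) n u v"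
    then show "\<exists>p. awalk u p v \<and> length p \<le> n"
    proof induction
      case (refl x n) then show ?case by (auto simp: awalk_Nil_iff intro!: exI[of _ "[]"])
    next
      case (step n x y z)
      then obtain p where "awalk x p y" "length p \<le> n" by auto
      moreover have "awalk y [(y, z)] z" using step by (auto simp: awalk_simps)
      ultimately show ?case by (intro exI[of _ "p @ [(y, z)]"]) auto
    qed
  next
    assume "\<exists>p. awalk u p v \<and> length p \<le> n"
    then obtain p where "awalk u p v" "length p \<le> n" by blast
    then show "walk_le (parcs G) (pverts G) n u v"
    proof (induction p arbitrary: u n)
      case Nil then show ?case by (auto simp: awalk_Nil_iff intro: walk_le.refl)
    next
      case (Cons e p)
      then obtain n' where n: "n = Suc n'" "length p \<le> n'" by (cases n) auto
      have "walk_le (parcs G) (pverts G) n' (snd e) v"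
        using Cons.prems n by (intro Cons.IH) (auto simp: awalk_Cons_iff)
      moreover have "walk_le (parcs G) (pverts G) (Suc 0) u (snd e)"
        using Cons.prems by (intro walk_le_edge) (auto simp: awalk_Cons_iff)
      ultimately have "walk_le (parcs G) (pverts G) (Suc 0 + n') u v" by (blast intro: walk_le_trans)
      then show ?case by (simp add: n)
    qed
  qed
qed

lemma graph_dist_le_iff:
  assumes "pair_graph G" "u \<in> pverts G" "r \<ge> 0"
  shows "graph_dist G u v \<le> ereal r \<longleftrightarrow> walk_le (parcs G) (pverts G) (nat \<lfloor>r\<rfloor>) u v"
proof -
  interpret pair_graph G by fact
  have cost: "awalk_cost (\<lambda>_. 1) p = real (length p)" for p :: "('a \<times> 'a) list"
    by (induction p) auto
  have "graph_dist G u v \<le> ereal r \<longleftrightarrow> (\<exists>p. awalk u p v \<and> length p \<le> nat \<lfloor>r\<rfloor>)"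
  proof
    assume "graph_dist G u v \<le> ereal r"
    \<comment> \<open>Strictness lets a walk be taken out of the infimum that defines the distance;
      its length is an integer below the floor of \<open>r\<close> plus one.\<close>
    also have "ereal r < ereal (of_int \<lfloor>r\<rfloor> + 1)" by simp
    finally obtain p where "awalk u p v" "real (length p) < of_int \<lfloor>r\<rfloor> + 1"
      unfolding graph_dist_def \<mu>_def cost by (auto simp: INF_less_iff)
    then show "\<exists>p. awalk u p v \<and> length p \<le> nat \<lfloor>r\<rfloor>"
      by (intro exI[of _ p]) (use assms(3) in linarith)
  next
    assume "\<exists>p. awalk u p v \<and> length p \<le> nat \<lfloor>r\<rfloor>"
    then obtain p where p: "awalk u p v" "length p \<le> nat \<lfloor>r\<rfloor>" by blast
    have "graph_dist G u v \<le> ereal (real (length p))"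
      using min_cost_le_walk_cost[OF p(1), of "\<lambda>_. 1"] by (simp add: graph_dist_def cost)
    also have "\<dots> \<le> ereal r" using p(2) assms(3) by simp linarith
    finally show "graph_dist G u v \<le> ereal r" .
  qed
  then show ?thesis using walk_le_iff_awalk[OF assms(1,2)] by simp
qed

text \<open>The arcs are symmetric, so the symmetric closure in the library's notion of
  connectedness adds nothing.\<close>

lemma connected_induce_iff:
  assumes "pair_graph G" "S \<subseteq> pverts G"
  shows "Digraph_Component.connected (induce_subgraph (with_proj G) S) \<longleftrightarrow>
    S \<noteq> {} \<and> (\<forall>u\<in>S. \<forall>v\<in>S. \<exists>n. walk_le (parcs G) S n u v)"
proof -
  interpret pair_graph G by fact
  have sym: "sym (parcs G)" using arcs_symmetric by (auto simp: sym_def)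
  let ?A = "arcs_ends (induce_subgraph (with_proj G) S)"
  have A: "?A = {(a, b). (a, b) \<in> parcs G \<and> a \<in> S \<and> b \<in> S}"
    by (force simp: arcs_ends_conv)
  have As: "?A\<^sup>s = ?A" using sym by (auto simp: A symcl_def sym_def)
  have "(u, v) \<in> rtrancl_on S ?A \<longleftrightarrow> (\<exists>n. walk_le (parcs G) S n u v)" for u v
  proof
    assume "(u, v) \<in> rtrancl_on S ?A"
    then show "\<exists>n. walk_le (parcs G) S n u v"
    proof induction
      case (step x y)
      then obtain n where "walk_le (parcs G) S n y v" by blast
      moreover have "walk_le (parcs G) S (Suc 0) x y"
        using step by (intro walk_le_edge) (auto simp: A)
      ultimately show ?case by (blast intro: walk_le_trans)
    qed (auto intro: walk_le.refl)
  next
    assume "\<exists>n. walk_le (parcs G) S n u v"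
    then obtain n where "walk_le (parcs G) S n u v" by blast
    then show "(u, v) \<in> rtrancl_on S ?A"
    proof induction
      case (step n x y z)
      then show ?case using walk_le_in[OF step.hyps(1)]
        by (auto simp: A intro: rtrancl_on_into_rtrancl_on)
    qed simp
  qed
  then show ?thesis unfolding connected_conv As by simp
qed

subsection \<open>Iterated layering\<close>

text \<open>The empty set counts as connected here, so the models below state nonemptiness
  separately.\<close>

definition connected_in :: "'a rel \<Rightarrow> 'a set \<Rightarrow> bool" where
  "connected_in E S \<longleftrightarrow> (\<forall>a\<in>S. \<forall>b\<in>S. \<exists>n. walk_le E S n a b)"

lemma connected_in_star:
  assumes "sym E" "\<And>a. a \<in> S \<Longrightarrow> \<exists>n. walk_le E S n x a"
  shows "connected_in E S"
  unfolding connected_in_def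
proof (intro ballI)
  fix a b assume "a \<in> S" "b \<in> S"
  then obtain m n where "walk_le E S m x a" "walk_le E S n x b" using assms(2) by blast
  then show "\<exists>n. walk_le E S n a b" using walk_le_trans[OF walk_le_sym[OF assms(1)]] by blast
qed

lemma connected_in_union:
  assumes E: "sym E" and S: "connected_in E S" and T: "connected_in E T"
    and st: "s \<in> S" "t \<in> T" "(s, t) \<in> E"
  shows "connected_in E (S \<union> T)"
proof (rule connected_in_star[OF E, of _ s])
  fix a assume "a \<in> S \<union> T"
  then consider "a \<in> S" | "a \<in> T" by blast
  then show "\<exists>n. walk_le E (S \<union> T) n s a"
  proof cases
    case 1
    then obtain n where "walk_le E S n s a" using S st by (auto simp: connected_in_def)
    from walk_le_mono[OF this] show ?thesis by blast
  next
    case 2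
    then obtain n where "walk_le E T n t a" using T st by (auto simp: connected_in_def)
    then have "walk_le E (S \<union> T) n t a" by (rule walk_le_mono) simp
    moreover have "walk_le E (S \<union> T) (Suc 0) s t" using st by (intro walk_le_edge) auto
    ultimately show ?thesis by (metis walk_le_trans)
  qed
qed

lemma connected_in_component: "sym E \<Longrightarrow> connected_in E (component E X v)"
  using component_connected by (force simp: connected_in_def)

lemma div_le_Suc_div:
  fixes a b e :: nat
  assumes "a \<le> b + e" "0 < e" shows "a div e \<le> Suc (b div e)"
  using div_le_mono[OF assms(1), of e] assms(2) by simp

text \<open>With truth values for \<open>P\<close>, this says that a chain cannot cross a threshold
  if no single step does.\<close>

lemma successively_constant:
  assumes "successively (\<lambda>x y. P x = P y) p" "u \<in> set p" "v \<in> set p"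
  shows "P u = P v"
proof -
  have "P x = P (hd p)" if "x \<in> set p" for x
    using assms(1) that by (induction p rule: induct_list012) auto
  then show ?thesis using assms by simp
qed

text \<open>The width \<open>2\<^sup>k R\<close> of the layers doubles from one round to the next. In an earlier round, a
  shortest walk from \<open>w\<^sub>j\<close> to the root stays in the slab for at most two layers of that round, so it
  is too short to leave the slabs of the later rounds, in which \<open>w\<^sub>j\<close> lies in the middle layer.\<close>

locale layering =
  fixes E :: "'a rel" and V :: "'a set" and R :: nat
  assumes sym_E: "sym E" and R_pos: "0 < R"
begin

text \<open>The choice depends on the set alone, so vertices with the same piece share a root and
  their bands are comparable.\<close>

definition root :: "'a set \<Rightarrow> 'a" where
  "root X = (SOME x. x \<in> X)"

definition band :: "nat \<Rightarrow> 'a set \<Rightarrow> 'a \<Rightarrow> nat" where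
  "band k X u = level E X (root X) u div (2 ^ k * R)"

text \<open>The neighbouring layers are kept so that, in a connected piece, a walk from
  \<open>v\<close> no longer than one layer width cannot leave; see
  \<open>walk_in_slab\<close>.\<close>

definition slab :: "nat \<Rightarrow> 'a set \<Rightarrow> 'a \<Rightarrow> 'a set" where
  "slab k X v = {u \<in> X. band k X u \<le> Suc (band k X v) \<and> band k X v \<le> Suc (band k X u)}"

text \<open>Every vertex is followed through its own sequence of pieces, so no global choice of
  components is made. \<open>same_piece\<close> tells when two sequences agree.\<close>

primrec piece :: "nat \<Rightarrow> 'a \<Rightarrow> 'a set" where
  "piece 0 v = component E V v"
| "piece (Suc k) v = component E (slab k (piece k v) v) v"

definition colour :: "nat \<Rightarrow> 'a \<Rightarrow> nat set" where
  "colour t v = {k. k < t \<and> odd (band k (piece k v) v)}"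

lemma width_pos: "0 < 2 ^ k * R"
  using R_pos by simp

lemma self_in_piece: "v \<in> V \<Longrightarrow> v \<in> piece k v"
  by (induction k) (auto simp: slab_def intro!: self_in_component)

lemma piece_connected: "connected_in E (piece k v)"
  using connected_in_component[OF sym_E] by (cases k) auto

lemma piece_Suc_subset: "piece (Suc k) v \<subseteq> slab k (piece k v) v"
  using component_subset by (metis piece.simps(2))

lemma piece_antimono: "k \<le> m \<Longrightarrow> piece m v \<subseteq> piece k v"
proof (induction m rule: dec_induct)
  case (step m)
  then show ?case using piece_Suc_subset[of m v] by (auto simp: slab_def)
qed simp

lemma piece_subset: "piece k v \<subseteq> V"
  using piece_antimono[of 0 k v] component_subset[of E V v] by auto

lemma walk_from_root:
  assumes "connected_in E X" "u \<in> X"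
  shows "root X \<in> X" "\<exists>n. walk_le E X n (root X) u"
proof -
  show "root X \<in> X" unfolding root_def using assms(2) by (rule someI)
  then show "\<exists>n. walk_le E X n (root X) u" using assms by (auto simp: connected_in_def)
qed

lemma band_diff:
  assumes X: "connected_in E X" and w: "walk_le E X n u v" and n: "n \<le> 2 ^ k * R"
  shows "band k X u \<le> Suc (band k X v)" "band k X v \<le> Suc (band k X u)"
proof -
  obtain m where "walk_le E X m (root X) u" using walk_from_root[OF X] walk_le_in[OF w] by blast
  note d = level_diff[OF sym_E this w]
  show "band k X u \<le> Suc (band k X v)" "band k X v \<le> Suc (band k X u)"
    unfolding band_def using d n by (auto intro!: div_le_Suc_div width_pos)
qed

lemma walk_in_slab:
  assumes X: "connected_in E X" and w: "walk_le E X n u v" and n: "n \<le> 2 ^ k * R"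
  shows "walk_le E (slab k X u) n u v"
  using w by (rule walk_le_restrict) (use band_diff[OF X _ n] in \<open>auto simp: slab_def dest: walk_le_in\<close>)

text \<open>Vertices joined by a walk of length at most \<open>R\<close> in a piece have bands
  differing by at most one, and equal parity makes the bands equal. Then the slabs coincide and the
  walk stays inside, which is why the induction carries it along.\<close>

lemma same_piece:
  assumes "u \<in> V" "walk_le E V R u v" "colour t u = colour t v" "k \<le> t"
  shows "piece k u = piece k v \<and> walk_le E (piece k u) R u v \<and>
    (\<forall>j<k. band j (piece j u) u = band j (piece j v) v)"
  using assms(4)
proof (induction k)
  case 0
  show ?case
    using component_eq[OF sym_E assms(2)] walk_le_component[OF assms(2)] by simp
next
  case (Suc k)
  define X where "X = piece k u"
  have X: "piece k u = X" "piece k v = X" "walk_le E X R u v" and con: "connected_in E X"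
    using Suc piece_connected by (auto simp: X_def)
  have n: "R \<le> 2 ^ k * R" by simp
  have "odd (band k X u) \<longleftrightarrow> odd (band k X v)"
  proof -
    have "k \<in> colour t u \<longleftrightarrow> k \<in> colour t v" using assms(3) by simp
    then show ?thesis using Suc.prems X by (simp add: colour_def Suc_le_eq)
  qed
  with band_diff[OF con X(3) n] have b: "band k X u = band k X v"
    by (metis Suc_leI even_Suc le_antisym le_neq_implies_less not_less_eq_eq)
  then have slab: "slab k X u = slab k X v" by (simp add: slab_def)
  note w = walk_in_slab[OF con X(3) n]
  show ?case
    using component_eq[OF sym_E w] walk_le_component[OF w] b Suc.IH Suc.prems
    by (auto simp: X slab less_Suc_eq)
qed

text \<open>From round \<open>Suc k\<close> on, every layer is at least \<open>2 ^ Suc k * R\<close>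
  wide, so the walk cannot get beyond the layers next to that of \<open>v\<close>.\<close>

lemma walk_in_later_piece:
  assumes "walk_le E (piece (Suc k) v) n v z" "n \<le> 2 ^ Suc k * R" "Suc k \<le> m"
  shows "walk_le E (piece m v) n v z"
  using assms(3)
proof (induction m rule: dec_induct)
  case base show ?case by fact
next
  case (step m)
  have "(2::nat) ^ Suc k \<le> 2 ^ m" using step.hyps(1) by (intro power_increasing) auto
  then have "n \<le> 2 ^ m * R" using assms(2) mult_le_mono1 order.trans by blast
  from walk_le_component[OF walk_in_slab[OF piece_connected step.IH this]] show ?case by simp
qed

lemma clique_model:
  assumes t: "2 \<le> t"
    and w_V: "\<And>j. j < t \<Longrightarrow> w j \<in> V"
    and w_piece: "\<And>j k. j < t \<Longrightarrow> k \<le> t \<Longrightarrow> piece k (w j) = X k"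
    and w_band: "\<And>j k. j < t \<Longrightarrow> k < t \<Longrightarrow> band k (X k) (w j) = b k"
    and far: "\<And>i j. i < j \<Longrightarrow> j < t \<Longrightarrow> \<not> walk_le E V (4 * (2 ^ t * R)) (w i) (w j)"
  shows "\<exists>S. (\<forall>j<t. S j \<subseteq> V \<and> S j \<noteq> {} \<and> connected_in E (S j)) \<and>
    (\<forall>i<t. \<forall>j<t. i \<noteq> j \<longrightarrow> S i \<inter> S j = {} \<and> (\<exists>u\<in>S i. \<exists>v\<in>S j. (u, v) \<in> E))"
proof -
  define l where "l k = level E (X k) (root (X k))" for k
  \<comment> \<open>The lowest level of the slab retained in round \<open>k\<close>. By
    \<open>b2\<close> the subtraction does not truncate and the value is positive.\<close>
  define a where "a k = (b k - 1) * (2 ^ k * R)" for k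
  define A where "A k = {u \<in> X k. l k u < a k}" for k
  \<comment> \<open>The radius is at least two layer widths of every round, enough to contain the
    descents from \<open>w j\<close> to the boundaries of all \<open>A k\<close>.\<close>
  define B where "B j = {u. walk_le E (X t) (2 ^ t * R) (w j) u}" for j

  have X_con: "connected_in E (X k)" and X_V: "X k \<subseteq> V" if "k \<le> t" for k
    using piece_connected[of k "w 0"] piece_subset[of k "w 0"] w_piece[of 0 k] t that by auto
  have w_X: "w j \<in> X k" if "j < t" "k \<le> t" for j k
    using self_in_piece[OF w_V] w_piece that by blast
  have X_mono: "X m \<subseteq> X k" if "k \<le> m" "m \<le> t" for k m
    using piece_antimono[OF that(1), of "w 0"] w_piece[of 0] t that by auto
  have band_l: "band k (X k) u = l k u div (2 ^ k * R)" for k u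
    by (simp add: band_def l_def)
  have X_Suc: "X (Suc k) = component E (slab k (X k) (w j)) (w j)" if "k < t" "j < t" for k j
    using w_piece[OF that(2), of "Suc k"] w_piece[OF that(2), of k] that by simp
  have width: "2 ^ Suc k * R \<le> 2 ^ t * R" if "k < t" for k
    using that by (intro mult_le_mono1 power_increasing) auto

  \<comment> \<open>In layer 0 or 1 all \<open>w j\<close> would be within two widths of the root,
    hence within four widths of each other, against \<open>far\<close>.\<close>
  have b2: "2 \<le> b k" if k: "k < t" for k
  proof (rule ccontr)
    assume "\<not> 2 \<le> b k"
    have "walk_le E V (2 ^ Suc k * R) (root (X k)) (w j)" if j: "j < t" for j
    proof -
      have "l k (w j) div (2 ^ k * R) < 2"
        using w_band[OF j k] \<open>\<not> 2 \<le> b k\<close> by (simp add: band_l)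
      then have le: "l k (w j) \<le> 2 ^ Suc k * R"
        using div_less_iff_less_mult[OF width_pos] by (simp add: less_imp_le)
      obtain m where "walk_le E (X k) m (root (X k)) (w j)"
        using walk_from_root(2)[OF X_con w_X] j k by (meson less_imp_le)
      then have "walk_le E (X k) (l k (w j)) (root (X k)) (w j)"
        unfolding l_def by (rule walk_le_level)
      then have "walk_le E V (l k (w j)) (root (X k)) (w j)"
        by (rule walk_le_mono) (use X_V k in auto)
      then show ?thesis using le by (rule walk_le_mono_length)
    qed
    from walk_le_trans[OF walk_le_sym[OF sym_E this[of 0]] this[of 1]] t
    have "walk_le E V (2 ^ Suc k * R + 2 ^ Suc k * R) (w 0) (w 1)" by simp
    then have "walk_le E V (4 * (2 ^ t * R)) (w 0) (w 1)"
      by (rule walk_le_mono_length) (use width[OF k] in linarith)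
    then show False using far[of 0 1] t by simp
  qed

  \<comment> \<open>Since \<open>w j\<close> lies in layer \<open>b k\<close> and \<open>a k\<close>
    starts layer \<open>b k - 1\<close>, a descent of at most two widths inside the slab reaches a
    vertex \<open>z\<close> at level \<open>a k\<close>. It survives in all later pieces, so
    \<open>z\<close> is in \<open>B j\<close>, and one more step down enters
    \<open>A k\<close>.\<close>
  have adj: "\<exists>u\<in>A k. \<exists>v\<in>B j. (u, v) \<in> E" if k: "k < t" and j: "j < t" for j k
  proof -
    let ?e = "2 ^ k * R"
    have e: "0 < ?e" by (rule width_pos)
    have bk: "l k (w j) div ?e = b k" using w_band[OF j k] by (simp add: band_l)
    have "b k * ?e \<le> l k (w j)" "l k (w j) < Suc (b k) * ?e"
      using bk e div_less_iff_less_mult[OF e, of "l k (w j)" "Suc (b k)"]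
      by (auto simp: less_eq_div_iff_mult_less_eq[OF e, symmetric] simp del: mult_Suc)
    moreover have "a k + ?e = b k * ?e" "0 < a k"
      using b2[OF k] e by (auto simp: a_def algebra_simps mult_eq_if)
    ultimately have "a k \<le> l k (w j)" "l k (w j) - a k \<le> 2 ^ Suc k * R" by auto
    then obtain d where d: "a k + d = l k (w j)" "d \<le> 2 ^ Suc k * R"
      by (metis le_add_diff_inverse)
    obtain m where m: "walk_le E (X k) m (root (X k)) (w j)"
      using walk_from_root(2)[OF X_con w_X] j k by (meson less_imp_le)
    obtain z where z: "l k z = a k"
      "walk_le E {u \<in> X k. a k \<le> l k u \<and> l k u \<le> l k (w j)} d (w j) z"
      using level_descent[OF sym_E m, of "a k" d] d by (auto simp: l_def)
    have "{u \<in> X k. a k \<le> l k u \<and> l k u \<le> l k (w j)} \<subseteq> slab k (X k) (w j)"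
    proof
      fix u assume u: "u \<in> {u \<in> X k. a k \<le> l k u \<and> l k u \<le> l k (w j)}"
      then have "a k div ?e \<le> l k u div ?e" "l k u div ?e \<le> b k"
        using div_le_mono[of "l k u" "l k (w j)" ?e] bk by (auto intro: div_le_mono)
      then show "u \<in> slab k (X k) (w j)"
        using u e bk by (auto simp: slab_def band_l a_def)
    qed
    from walk_le_component[OF walk_le_mono[OF z(2) this]]
    have "walk_le E (piece (Suc k) (w j)) d (w j) z"
      using X_Suc[OF k j] w_piece[OF j, of "Suc k"] k by simp
    from walk_in_later_piece[OF this d(2), of t]
    have "walk_le E (X t) d (w j) z" using k w_piece[OF j, of t] by simp
    then have zB: "z \<in> B j"
      unfolding B_def using walk_le_mono_length d(2) width[OF k] by (metis le_trans mem_Collect_eq)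
    have "z \<in> X k" using walk_le_in(2)[OF z(2)] by simp
    then obtain m' where m': "walk_le E (X k) m' (root (X k)) z"
      using walk_from_root[OF X_con] k by (meson less_imp_le)
    obtain y where y: "l k y = a k - 1" "walk_le E {u \<in> X k. a k - 1 \<le> l k u \<and> l k u \<le> l k z} 1 z y"
      using level_descent[OF sym_E m', of "a k - 1" 1] z(1) \<open>0 < a k\<close> by (auto simp: l_def)
    have "y \<in> A k" using walk_le_in(2)[OF y(2)] y(1) \<open>0 < a k\<close> by (auto simp: A_def)
    moreover have "y \<noteq> z" using y(1) z(1) \<open>0 < a k\<close> by auto
    then have "(z, y) \<in> E" using y(2) by (auto elim!: walk_le.cases)
    ultimately show ?thesis using zB sym_E by (meson symD)
  qed

  \<comment> \<open>The ball lies strictly below the slab, so it misses the next piece and with it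
    every later \<open>A j\<close> and every \<open>B j\<close>.\<close>
  have A_X: "A k \<inter> X (Suc k) = {}" if k: "k < t" for k
  proof -
    have "a k \<le> l k u" if "u \<in> X (Suc k)" for u
    proof -
      have "u \<in> slab k (X k) (w 0)" using that X_Suc[OF k, of 0] t component_subset by fastforce
      then have "b k - 1 \<le> l k u div (2 ^ k * R)"
        using w_band[of 0 k] t k by (auto simp: slab_def band_l)
      then show ?thesis using less_eq_div_iff_mult_less_eq[OF width_pos] by (simp add: a_def)
    qed
    then show ?thesis by (fastforce simp: A_def)
  qed
  have A_disj: "A i \<inter> A j = {}" if "i < j" "j < t" for i j
    using A_X[of i] X_mono[of "Suc i" j] that by (auto simp: A_def)
  have AB_disj: "A i \<inter> B j = {}" if "i < t" for i j
    using A_X[of i] X_mono[of "Suc i" t] that by (auto simp: B_def dest!: walk_le_in)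
  have B_disj: "B i \<inter> B j = {}" if "i < j" "j < t" for i j
  proof (rule ccontr)
    assume "B i \<inter> B j \<noteq> {}"
    then obtain u where "walk_le E (X t) (2 ^ t * R) (w i) u" "walk_le E (X t) (2 ^ t * R) (w j) u"
      by (auto simp: B_def)
    from walk_le_trans[OF this(1) walk_le_sym[OF sym_E this(2)]]
    have "walk_le E V (2 ^ t * R + 2 ^ t * R) (w i) (w j)" by (rule walk_le_mono) (use X_V in auto)
    then have "walk_le E V (4 * (2 ^ t * R)) (w i) (w j)" by (rule walk_le_mono_length) simp
    then show False using far that by blast
  qed
  have A_con: "connected_in E (A k)" if k: "k < t" for k
  proof (rule connected_in_star[OF sym_E, of _ "root (X k)"])
    fix u assume u: "u \<in> A k"
    then obtain m where "walk_le E (X k) m (root (X k)) u"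
      using walk_from_root(2)[OF X_con, of k u] less_imp_le[OF k] by (auto simp: A_def)
    from walk_le_below_level[OF this, of "a k"] u
    show "\<exists>n. walk_le E (A k) n (root (X k)) u" by (auto simp: A_def l_def)
  qed
  have B_con: "connected_in E (B j)" for j
  proof (rule connected_in_star[OF sym_E, of _ "w j"])
    fix u assume "u \<in> B j"
    then have "walk_le E (X t) (2 ^ t * R) (w j) u" by (simp add: B_def)
    then have "walk_le E (B j) (2 ^ t * R) (w j) u"
      by (rule walk_le_restrict) (simp add: B_def)
    then show "\<exists>n. walk_le E (B j) n (w j) u" ..
  qed

  show ?thesis
  proof (intro exI[of _ "\<lambda>j. A j \<union> B j"] conjI allI impI)
    fix j assume j: "j < t"
    show "A j \<union> B j \<subseteq> V" using X_V[of j] X_V[of t] j by (auto simp: A_def B_def dest!: walk_le_in)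
    obtain u v where uv: "u \<in> A j" "v \<in> B j" "(u, v) \<in> E" using adj[OF j j] by blast
    then show "A j \<union> B j \<noteq> {}" by blast
    show "connected_in E (A j \<union> B j)" by (rule connected_in_union[OF sym_E A_con[OF j] B_con uv])
  next
    fix i j assume ij: "i < t" "j < t" "i \<noteq> j"
    show "(A i \<union> B i) \<inter> (A j \<union> B j) = {}"
      using A_disj[of i j] A_disj[of j i] B_disj[of i j] B_disj[of j i] AB_disj[OF ij(1)] AB_disj[OF ij(2)] ij
      by (cases i j rule: linorder_cases) (simp_all add: Int_Un_distrib Int_Un_distrib2 Int_commute)
    show "\<exists>u\<in>A i \<union> B i. \<exists>v\<in>A j \<union> B j. (u, v) \<in> E" using adj[OF ij(1,2)] by blast
  qed
qed

lemma same_piece_on_chain: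
  assumes p: "successively (walk_le E V R) p" "set p \<subseteq> V" "\<forall>v\<in>set p. colour t v = c"
    and uv: "u \<in> set p" "v \<in> set p"
  shows "(\<forall>k\<le>t. piece k u = piece k v) \<and> (\<forall>k<t. band k (piece k u) u = band k (piece k v) v)"
proof -
  \<comment> \<open>One value collects all pieces and bands, so that a single use of
    \<open>successively_constant\<close> covers every round.\<close>
  define F where "F x = (map (\<lambda>k. piece k x) [0..<Suc t], map (\<lambda>k. band k (piece k x) x) [0..<t])" for x
  have F_iff: "F x = F y \<longleftrightarrow>
      (\<forall>k\<le>t. piece k x = piece k y) \<and> (\<forall>k<t. band k (piece k x) x = band k (piece k y) y)" for x y
    unfolding F_def prod.inject map_eq_conv set_upt atLeastLessThan_iff Ball_def less_Suc_eq_le by simp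
  have "successively (\<lambda>x y. F x = F y) p"
  proof (rule successively_mono[OF p(1)])
    fix x y assume "x \<in> set p" "y \<in> set p" and w: "walk_le E V R x y"
    then have "x \<in> V" "colour t x = colour t y" using p(2,3) by auto
    note same = same_piece[OF this(1) w this(2)]
    show "F x = F y"
      unfolding F_iff using same[THEN conjunct1] same[OF order_refl, THEN conjunct2, THEN conjunct2] by blast
  qed
  from successively_constant[OF this uv] show ?thesis unfolding F_iff .
qed

text \<open>A discrete intermediate value argument: levels from \<open>u\<close> change by at most
  \<open>R\<close> per step and run from 0 to beyond \<open>t * Suc (q + R)\<close>, so the chain
  meets each window \<open>[j * Suc (q + R), j * Suc (q + R) + R]\<close>. Different windows are
  more than \<open>q\<close> apart.\<close>

lemma separated_on_chain:
  assumes p: "successively (walk_le E V R) p" "u \<in> set p" "v \<in> set p" "set p \<subseteq> V"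
    and far: "\<not> walk_le E V (t * Suc (q + R)) u v"
  obtains w where "\<And>j. j < t \<Longrightarrow> w j \<in> set p"
    "\<And>i j. i < j \<Longrightarrow> j < t \<Longrightarrow> \<not> walk_le E V q (w i) (w j)"
proof -
  let ?l = "level E V u" and ?s = "Suc (q + R)"
  \<comment> \<open>Levels are meaningful only for vertices joined to \<open>u\<close>, a property
    that passes along the chain.\<close>
  let ?Q = "\<lambda>y. \<exists>m. walk_le E V m u y"
  have "successively (\<lambda>x y. ?Q x = ?Q y) p"
  proof (rule successively_mono[OF p(1)])
    fix x y assume xy: "walk_le E V R x y"
    show "?Q x = ?Q y"
      using walk_le_trans[OF _ xy] walk_le_trans[OF _ walk_le_sym[OF sym_E xy]] by blast
  qed
  moreover have "?Q u" using p(2,4) walk_le.refl[of u V E 0] by blast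
  ultimately have reach: "?Q y" if "y \<in> set p" for y
    using successively_constant[of ?Q p, OF _ p(2) that] by simp
  have "t * ?s < ?l v"
  proof (rule ccontr)
    assume "\<not> t * ?s < ?l v"
    then show False using far reach[OF p(3)] walk_le_level walk_le_mono_length by (metis leI)
  qed
  have "\<exists>y\<in>set p. j * ?s \<le> ?l y \<and> ?l y \<le> j * ?s + R" if j: "j < t" for j
  proof (rule ccontr)
    assume none: "\<not> ?thesis"
    have "successively (\<lambda>x y. (?l x < j * ?s) = (?l y < j * ?s)) p"
    proof (rule successively_mono[OF p(1)])
      fix x y assume xy: "x \<in> set p" "y \<in> set p" "walk_le E V R x y"
      obtain m where "walk_le E V m u x" using reach xy by blast
      note level_diff[OF sym_E this xy(3)]
      moreover have "?l x < j * ?s \<or> j * ?s + R < ?l x" "?l y < j * ?s \<or> j * ?s + R < ?l y"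
        using none xy(1,2) by (auto simp: not_le)
      ultimately show "(?l x < j * ?s) = (?l y < j * ?s)" by linarith
    qed
    from successively_constant[OF this p(2,3)]
    have "(?l u < j * ?s) = (?l v < j * ?s)" .
    moreover have "?l u = 0" using level_le[OF walk_le.refl[of u V E 0]] p(2,4) by auto
    then have "?l u < j * ?s" using none p(2) by fastforce
    moreover have "j * ?s \<le> t * ?s" using j by (intro mult_le_mono1) simp
    ultimately show False using \<open>t * ?s < ?l v\<close> by simp
  qed
  then obtain w where w: "\<And>j. j < t \<Longrightarrow> w j \<in> set p \<and> j * ?s \<le> ?l (w j) \<and> ?l (w j) \<le> j * ?s + R"
    by metis
  have "\<not> walk_le E V q (w i) (w j)" if ij: "i < j" "j < t" for i j
  proof
    assume "walk_le E V q (w i) (w j)"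
    moreover obtain m where "walk_le E V m u (w i)" using reach w ij by (meson less_trans)
    ultimately have "?l (w j) \<le> ?l (w i) + q" using level_diff[OF sym_E] by blast
    moreover have "Suc i * ?s \<le> j * ?s" using ij by (intro mult_le_mono1) simp
    ultimately show False using w[of i] w[of j] ij by auto
  qed
  with w that show ?thesis by blast
qed

lemma chain_bounded_or_clique_model:
  assumes t: "2 \<le> t"
    and p: "successively (walk_le E V R) p" "set p \<subseteq> V" "\<forall>v\<in>set p. colour t v = c"
    and uv: "u \<in> set p" "v \<in> set p" "\<not> walk_le E V (t * (6 * (2 ^ t * R))) u v"
  shows "\<exists>S. (\<forall>j<t. S j \<subseteq> V \<and> S j \<noteq> {} \<and> connected_in E (S j)) \<and>
    (\<forall>i<t. \<forall>j<t. i \<noteq> j \<longrightarrow> S i \<inter> S j = {} \<and> (\<exists>x\<in>S i. \<exists>y\<in>S j. (x, y) \<in> E))"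
proof -
  \<comment> \<open>The factor 6 is 4 for the separation needed by \<open>clique_model\<close>, plus
    1 for the step length \<open>R\<close> and 1 for the \<open>Suc\<close>.\<close>
  have "R \<le> 2 ^ t * R" by simp
  then have "Suc (4 * (2 ^ t * R) + R) \<le> 6 * (2 ^ t * R)"
    using R_pos by linarith
  then have "t * Suc (4 * (2 ^ t * R) + R) \<le> t * (6 * (2 ^ t * R))" by (rule mult_le_mono2)
  from uv(3) walk_le_mono_length[OF _ this]
  have far: "\<not> walk_le E V (t * Suc (4 * (2 ^ t * R) + R)) u v" by (rule contrapos_nn)
  obtain w where w: "\<And>j. j < t \<Longrightarrow> w j \<in> set p"
    "\<And>i j. i < j \<Longrightarrow> j < t \<Longrightarrow> \<not> walk_le E V (4 * (2 ^ t * R)) (w i) (w j)"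
    using separated_on_chain[OF p(1) uv(1,2) p(2) far] by blast
  note same = same_piece_on_chain[OF p uv(1) w(1)]
  show ?thesis
  proof (rule clique_model[of t w "\<lambda>k. piece k u" "\<lambda>k. band k (piece k u) u"])
    show "w j \<in> V" if "j < t" for j using w(1)[OF that] p(2) by blast
    show "piece k (w j) = piece k u" if "j < t" "k \<le> t" for j k using same that by simp
    show "band k (piece k u) (w j) = band k (piece k u) u" if "j < t" "k < t" for j k
    proof -
      have "piece k u = piece k (w j)" "band k (piece k u) u = band k (piece k (w j)) (w j)"
        using same[OF that(1)] that(2) less_imp_le by blast+
      then show ?thesis by (simp only:)
    qed
  qed (use t w in auto)
qed


end

section \<open>From an excluded minor to a linear control function\<close>

text \<open>A model of the complete graph on \<open>t\<close> vertices yields one of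
  \<open>H\<close> by numbering the vertices of \<open>H\<close>. The added 2 ensures
  \<open>2 <= t\<close>, as \<open>clique_model\<close> compares two of the far vertices.\<close>

lemma minor_free_imp_colouring:
  assumes G: "pair_graph G" and H: "pair_graph H" and free: "minor_free H G" and r: "0 < r"
    and t: "t = card (pverts H) + 2"
  shows "\<exists>(C :: nat set) c. is_colouring G (2 ^ t) r (real (t * (6 * 2 ^ t)) * r) C c"
proof -
  interpret G: pair_graph G by fact
  interpret H: pair_graph H by fact
  let ?E = "parcs G" and ?V = "pverts G"
  define R where "R = nat \<lfloor>r\<rfloor>"
  have sym: "sym ?E" using G.arcs_symmetric by (auto simp: sym_def)
  have dist: "graph_dist G u v \<le> ereal x \<longleftrightarrow> walk_le ?E ?V (nat \<lfloor>x\<rfloor>) u v"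
    if "u \<in> ?V" "0 \<le> x" for u v x
    using graph_dist_le_iff[OF G that] .
  have chain: "successively (walk_le ?E ?V R) p" if p: "r_path G r p" for p
  proof (rule successively_mono)
    show "successively (\<lambda>u v. graph_dist G u v \<le> ereal r) p" using p by (simp add: r_path_def)
    show "walk_le ?E ?V R u v" if "u \<in> set p" "v \<in> set p" and uv: "graph_dist G u v \<le> ereal r" for u v
    proof -
      have "u \<in> ?V" using that(1) p by (auto simp: r_path_def)
      from dist[OF this less_imp_le[OF r]] uv show ?thesis by (simp add: R_def)
    qed
  qed
  \<comment> \<open>For \<open>r < 1\<close> the layers would have width 0, but then an
    \<open>r\<close>-path never moves and one colour suffices.\<close>
  define col where "col = (if R = 0 then \<lambda>_. {} else layering.colour ?E ?V R t)"
  have walk: "walk_le ?E ?V (t * (6 * (2 ^ t * R))) u v"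
    if p: "r_path G r p" "\<forall>v\<in>set p. col v = k" "u \<in> set p" "v \<in> set p" for p k u v
  proof (cases "R = 0")
    case True
    have "successively (\<lambda>x y. (x = u) = (y = u)) p"
      using chain[OF p(1)] by (rule successively_mono) (auto simp: True walk_le_0_iff)
    from successively_constant[OF this p(3,4)] have "v = u" by simp
    then show ?thesis using p by (auto simp: r_path_def intro: walk_le.refl)
  next
    case False
    then interpret layering ?E ?V R using sym by unfold_locales auto
    show ?thesis
    proof (rule ccontr)
      assume far: "\<not> ?thesis"
      have "2 \<le> t" "set p \<subseteq> ?V" "\<forall>v\<in>set p. colour t v = k"
        using p False t by (simp_all add: col_def r_path_def)
      from chain_bounded_or_clique_model[OF this(1) chain[OF p(1)] this(2,3) p(3,4) far]
      obtain S where model: "(\<forall>j<t. S j \<subseteq> ?V \<and> S j \<noteq> {} \<and> connected_in ?E (S j)) \<and>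
          (\<forall>i<t. \<forall>j<t. i \<noteq> j \<longrightarrow> S i \<inter> S j = {} \<and> (\<exists>x\<in>S i. \<exists>y\<in>S j. (x, y) \<in> ?E))" ..
      have S: "S j \<subseteq> ?V \<and> S j \<noteq> {} \<and> connected_in ?E (S j)" if "j < t" for j
        using model[THEN conjunct1] that by simp
      have S_pair: "S i \<inter> S j = {} \<and> (\<exists>x\<in>S i. \<exists>y\<in>S j. (x, y) \<in> ?E)"
        if "i < t" "j < t" "i \<noteq> j" for i j
        using model[THEN conjunct2] that by simp
      obtain g where g: "bij_betw g (pverts H) {0..<card (pverts H)}"
        using ex_bij_betw_finite_nat[OF H.finite_verts] by blast
      have g_less: "g x < t" if "x \<in> pverts H" for x
        using bij_betwE[OF g, rule_format, OF that] t by simp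
      have g_inj: "g x \<noteq> g y" if "x \<in> pverts H" "y \<in> pverts H" "x \<noteq> y" for x y
        using g that by (auto simp: bij_betw_def inj_on_def)
      have "is_minor H G" unfolding is_minor_def
      proof (intro exI[of _ "\<lambda>x. S (g x)"] conjI ballI impI)
        fix x assume x: "x \<in> pverts H"
        show "S (g x) \<subseteq> ?V" using S[OF g_less[OF x]] by blast
        then show "Digraph_Component.connected (induce_subgraph (with_proj G) (S (g x)))"
          using S[OF g_less[OF x]] by (auto simp: connected_induce_iff[OF G] connected_in_def)
      next
        fix x y assume "x \<in> pverts H" "y \<in> pverts H" "x \<noteq> y"
        then show "S (g x) \<inter> S (g y) = {}" using S_pair[OF g_less g_less g_inj] by simp
      next
        fix e assume e: "e \<in> parcs H"
        obtain x y where [simp]: "e = (x, y)" by (cases e)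
        have "x \<in> pverts H" "y \<in> pverts H" "x \<noteq> y"
          using e H.wellformed' H.no_loops' by auto
        then show "case e of (x, y) \<Rightarrow> \<exists>u\<in>S (g x). \<exists>v\<in>S (g y). (u, v) \<in> parcs G"
          using S_pair[OF g_less g_less g_inj, of x y] by simp
      qed
      then show False using free by (simp add: minor_free_def)
    qed
  qed
  \<comment> \<open>Colours so far are sets of rounds; \<open>h\<close> codes the
    \<open>2 ^ t\<close> of them as natural numbers, as \<open>control_function\<close>
    requires.\<close>
  have "card (Pow {..<t}) = 2 ^ t" by (simp add: card_Pow)
  then obtain h where h: "bij_betw h (Pow {..<t}) {0..<(2::nat) ^ t}"
    using ex_bij_betw_finite_nat[of "Pow {..<t}"] by auto
  have col_Pow: "col v \<in> Pow {..<t}" for v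
  proof (cases "R = 0")
    case False
    then interpret layering ?E ?V R using sym by unfold_locales auto
    show ?thesis by (auto simp: col_def colour_def)
  qed (simp add: col_def)
  have "is_colouring G (2 ^ t) r (real (t * (6 * 2 ^ t)) * r) {0..<2 ^ t} (\<lambda>v. h (col v))"
    unfolding is_colouring_def
  proof (intro conjI allI impI)
    show "(\<lambda>v. h (col v)) ` ?V \<subseteq> {0..<2 ^ t}" using bspec[OF bij_betwE[OF h] col_Pow] by (rule image_subsetI)
  next
    fix p assume p: "r_path G r p \<and> (\<exists>k. \<forall>v\<in>set p. h (col v) = k)"
    have "col u = col v" if "u \<in> set p" "v \<in> set p" for u v
    proof (rule inj_onD[OF bij_betw_imp_inj_on[OF h]])
      show "h (col u) = h (col v)" using p that by metis
    qed (rule col_Pow)+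
    moreover have "hd p \<in> set p" using p by (simp add: r_path_def)
    ultimately have k: "\<forall>v\<in>set p. col v = col (hd p)" by (intro ballI)
    have "graph_dist G u v \<le> ereal (real (t * (6 * 2 ^ t)) * r)" if uv: "u \<in> set p" "v \<in> set p" for u v
    proof -
      have "u \<in> ?V" using p uv by (auto simp: r_path_def)
      define N where "N = t * (6 * (2 ^ t * R))"
      have "walk_le ?E ?V N u v" unfolding N_def using p by (intro walk[OF _ k uv]) simp
      then have "graph_dist G u v \<le> ereal (real N)" using dist[OF \<open>u \<in> ?V\<close>, of "real N" v] by simp
      also have "real N = real (t * (6 * 2 ^ t)) * real R" by (simp add: N_def)
      also have "ereal \<dots> \<le> ereal (real (t * (6 * 2 ^ t)) * r)"
        unfolding ereal_less_eq by (intro mult_left_mono) (use r in \<open>auto simp: R_def\<close>)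
      finally show ?thesis .
    qed
    then show "weak_diam G (set p) \<le> ereal (real (t * (6 * 2 ^ t)) * r)"
      unfolding weak_diam_def by (intro SUP_least)
  qed simp_all
  then show ?thesis by blast
qed

subsection \<open>Monochromatic crossings of king grids\<close>

text \<open>Coordinates from \<open>n\<close> on are frozen at \<open>p\<close>, as in \<^locale>\<open>kuhn_simplex\<close>.\<close>

definition grid :: "nat \<Rightarrow> nat \<Rightarrow> (nat \<Rightarrow> nat) set" where
  "grid n p = {x. (\<forall>i<n. x i \<le> p) \<and> (\<forall>i\<ge>n. x i = p)}"

text \<open>Sup-norm distance at most one, equality included. Any two vertices of a simplex in
  Kuhn's lemma are related in this way.\<close>

definition king :: "(nat \<Rightarrow> nat) \<Rightarrow> (nat \<Rightarrow> nat) \<Rightarrow> bool" where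
  "king x y \<longleftrightarrow> (\<forall>i. x i \<le> Suc (y i) \<and> y i \<le> Suc (x i))"

lemma king_sym: "king x y \<Longrightarrow> king y x"
  by (simp add: king_def)

lemma finite_grid: "finite (grid n p)"
proof (rule finite_subset)
  show "grid n p \<subseteq> (\<lambda>f i. if i < n then f i else p) ` ({..<n} \<rightarrow>\<^sub>E {..p})"
  proof
    fix x assume x: "x \<in> grid n p"
    show "x \<in> (\<lambda>f i. if i < n then f i else p) ` ({..<n} \<rightarrow>\<^sub>E {..p})"
      by (rule image_eqI[of _ _ "restrict x {..<n}"]) (use x in \<open>auto simp: grid_def fun_eq_iff\<close>)
  qed
  show "finite ((\<lambda>f i. if i < n then f i else p) ` ({..<n} \<rightarrow>\<^sub>E {..p}))"
    by (intro finite_imageI finite_PiE) auto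
qed

text \<open>If no monochromatic component met two opposite faces, then letting \<open>lab x j\<close> say whether the
  component of \<open>x\<close> meets the face \<open>x\<^sub>j = p\<close> would satisfy the boundary conditions of Kuhn's lemma. But
  \<open>lab\<close> is constant on components, of which a simplex meets at most \<open>n\<close>, one for each colour.\<close>

lemma monochromatic_crossing:
  fixes c :: "(nat \<Rightarrow> nat) \<Rightarrow> 'c"
  assumes p: "0 < p" and C: "finite C" "card C = n" "c ` grid n p \<subseteq> C"
  defines "S \<equiv> {(x, y). x \<in> grid n p \<and> y \<in> grid n p \<and> king x y \<and> c x = c y}"
  shows "\<exists>j<n. \<exists>x\<in>grid n p. \<exists>y\<in>grid n p. (x, y) \<in> S\<^sup>* \<and> x j = 0 \<and> y j = p"
proof (rule ccontr)
  assume none: "\<not> ?thesis"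
  define lab :: "(nat \<Rightarrow> nat) \<Rightarrow> nat \<Rightarrow> nat"
    where "lab x j = (if \<exists>y. (x, y) \<in> S\<^sup>* \<and> y j = p then 1 else 0)" for x j
  have grid_S: "x = y \<or> x \<in> grid n p \<and> y \<in> grid n p" if "(x, y) \<in> S\<^sup>*" for x y
    using that by induction (auto simp: S_def)
  have sym_S: "sym S" by (auto simp: sym_def S_def king_sym)
  have "odd (card {s. ksimplex p n s \<and> (reduced n \<circ> lab) ` s = {..n}})"
  proof (rule kuhn_combinatorial[OF p]; intro allI impI; elim conjE)
    fix x :: "nat \<Rightarrow> nat" and j assume j: "j < n"
    { assume "x j = 0"
      then show "lab x j = 0" using none grid_S j p by (fastforce simp: lab_def) }
    { assume "x j = p"
      then show "lab x j = 1" by (auto simp: lab_def) }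
  qed
  then have "{s. ksimplex p n s \<and> (reduced n \<circ> lab) ` s = {..n}} \<noteq> {}"
    using odd_card_imp_not_empty by blast
  then obtain s where s: "ksimplex p n s" "(reduced n \<circ> lab) ` s = {..n}" by blast
  then obtain base upd where "kuhn_simplex p n base upd s" by (auto elim: ksimplex.cases)
  then interpret kuhn_simplex p n base upd s .
  have s_grid: "s \<subseteq> grid n p" using out_eq_p s_le_p by (auto simp: grid_def)
  have fin: "finite s" and card_s: "card s = Suc n" using ksimplex_card[OF s(1)] by (auto intro: card_ge_0_finite)
  \<comment> \<open>The \<open>n + 1\<close> vertices carry all \<open>n + 1\<close> labels, hence
    distinct ones, while two of them must share one of the \<open>n\<close> colours.\<close>
  have "inj_on (reduced n \<circ> lab) s" by (rule eq_card_imp_inj_on) (use fin card_s s in auto)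
  moreover have "\<not> inj_on c s"
    using card_inj_on_le[of c s C] C s_grid card_s by auto
  ultimately obtain x y where xy: "x \<in> s" "y \<in> s" "c x = c y" "(reduced n \<circ> lab) x \<noteq> (reduced n \<circ> lab) y"
    by (auto simp: inj_on_def)
  have "x i \<le> Suc (y i) \<and> y i \<le> Suc (x i)" for i
    using base_le[of x i] base_le[of y i] le_Suc_base[of x i] le_Suc_base[of y i] xy by linarith
  then have "(x, y) \<in> S" "(y, x) \<in> S" using xy s_grid by (auto simp: S_def king_def)
  then have "lab x = lab y"
    by (auto simp: lab_def fun_eq_iff intro: converse_rtrancl_into_rtrancl)
  then show False using xy by simp
qed

lemma rtrancl_imp_chain:
  assumes "(x, y) \<in> S\<^sup>*"
  shows "\<exists>p. p \<noteq> [] \<and> x \<in> set p \<and> y \<in> set p \<and> last p = y \<and> successively (\<lambda>a b. (a, b) \<in> S) p \<and>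
    (\<forall>z\<in>set p. (x, z) \<in> S\<^sup>*)"
  using assms
proof induction
  case base
  show ?case by (intro exI[of _ "[x]"]) auto
next
  case (step y z)
  then obtain p where "p \<noteq> []" "x \<in> set p" "y \<in> set p" "last p = y"
    "successively (\<lambda>a b. (a, b) \<in> S) p" "\<forall>z\<in>set p. (x, z) \<in> S\<^sup>*" by blast
  then show ?case
    using step.hyps by (intro exI[of _ "p @ [z]"]) (auto simp: successively_append_iff)
qed

subsection \<open>Subdivisions with prescribed edge lengths\<close>

text \<open>Every level from 0 to that of \<open>v\<close> occurs in \<open>X\<close>, so a shortest
  walk has fewer edges than \<open>X\<close> has vertices.\<close>

lemma walk_le_card:
  assumes "sym E" "finite X" "walk_le E X n u v" shows "walk_le E X (card X) u v"
proof -
  let ?l = "level E X u"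
  have "{..?l v} \<subseteq> ?l ` X"
  proof
    fix a assume "a \<in> {..?l v}"
    then have "a + (?l v - a) = ?l v" by simp
    from level_descent[OF assms(1,3) this]
    obtain z where "?l z = a" "z \<in> X" by (auto dest: walk_le_in)
    then show "a \<in> ?l ` X" by blast
  qed
  then have "card {..?l v} \<le> card X"
    using card_mono[OF finite_imageI[OF assms(2)]] card_image_le[OF assms(2)] le_trans by blast
  then show ?thesis
    using walk_le_mono_length[OF walk_le_level[OF assms(3)]] by simp
qed

lemma walk_le_lipschitz:
  fixes \<phi> :: "'a \<Rightarrow> int"
  assumes "walk_le E X n u v" "\<And>a b. (a, b) \<in> E \<Longrightarrow> \<bar>\<phi> a - \<phi> b\<bar> \<le> 1"
  shows "\<bar>\<phi> u - \<phi> v\<bar> \<le> int n"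
  using assms(1)
proof induction
  case (step n x y z)
  then show ?case using assms(2)[of y z] by simp
qed simp

lemma walk_le_transfer:
  assumes "walk_le E X n u v" "X \<subseteq> Y"
    "\<And>a b. (a, b) \<in> E \<Longrightarrow> a \<in> X \<Longrightarrow> b \<in> X \<Longrightarrow> walk_le E' Y 1 a b"
  shows "walk_le E' Y n u v"
  using assms(1)
proof induction
  case (step n x y z)
  then show ?case using walk_le_trans[OF step.IH assms(3)[of y z]] walk_le_in[OF step.hyps(1)] by simp
qed (use assms(2) in \<open>auto intro: walk_le.refl\<close>)

text \<open>Extending Lipschitz functions to \<open>G'\<close> is what bounds its distances from below.\<close>

lemma weighted_subdivision:
  fixes G :: "nat pair_pre_digraph" and len :: "nat \<times> nat \<Rightarrow> nat"
  assumes "pair_graph G"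
    and "\<And>a b. (a, b) \<in> parcs G \<Longrightarrow> 0 < len (a, b) \<and> len (a, b) = len (b, a)"
  shows "\<exists>G'. subdivision_pair G G' \<and> pair_graph G' \<and> pverts G \<subseteq> pverts G' \<and>
    (\<forall>a b. (a, b) \<in> parcs G \<longrightarrow> walk_le (parcs G') (pverts G') (len (a, b)) a b) \<and>
    (\<forall>\<phi> :: nat \<Rightarrow> int. (\<forall>a b. (a, b) \<in> parcs G \<longrightarrow> \<bar>\<phi> a - \<phi> b\<bar> \<le> int (len (a, b))) \<longrightarrow>
      (\<exists>\<psi>. (\<forall>x\<in>pverts G. \<psi> x = \<phi> x) \<and> (\<forall>a b. (a, b) \<in> parcs G' \<longrightarrow> \<bar>\<psi> a - \<psi> b\<bar> \<le> 1)))"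
  using assms
\<comment> \<open>The measure is the total excess of lengths over 1. Splitting one edge lowers it by
  two, as both directions are counted.\<close>
proof (induction "\<Sum>e\<in>parcs G. len e - 1" arbitrary: G len rule: less_induct)
  case less
  interpret G: pair_graph G by fact
  note len = less.prems(2)
  have base: "subdivision_pair G G"
    by (rule subdivision_pair_base) unfold_locales
  show ?case
  proof (cases "\<exists>e\<in>parcs G. len e \<noteq> 1")
    case False
    then have one: "len (a, b) = 1" if "(a, b) \<in> parcs G" for a b using that by blast
    show ?thesis
      using base less.prems(1) one
      by (intro exI[of _ G]) (auto dest: G.wellformed' intro: walk_le_edge[where n=0, simplified])
  next
    case True
    then obtain u v where uv: "(u, v) \<in> parcs G" "len (u, v) \<noteq> 1" by auto
    define m where "m = len (u, v)"
    have m: "1 < m" "len (u, v) = m" "len (v, u) = m" using len[OF uv(1)] uv(2) by (auto simp: m_def)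
    have vu: "(v, u) \<in> parcs G" "u \<noteq> v" "u \<in> pverts G" "v \<in> pverts G"
      using uv(1) G.arcs_symmetric G.no_loops' G.wellformed' by blast+
    obtain w where w: "w \<notin> pverts G" using ex_new_if_finite[OF infinite_UNIV_nat G.finite_verts] by blast
    then have wuv: "w \<noteq> u" "w \<noteq> v" using vu by auto
    define G1 where "G1 = subdivide G (u, v) w"
    define P where "P = parcs G - {(u, v), (v, u)}"
    \<comment> \<open>The new vertex cuts off one unit edge at \<open>u\<close> and leaves length
      \<open>m - 1\<close> towards \<open>v\<close>.\<close>
    define len1 where "len1 = len((u, w) := 1, (w, u) := 1, (w, v) := m - 1, (v, w) := m - 1)"
    have arcs1: "parcs G1 = P \<union> {(u, w), (w, u), (w, v), (v, w)}"
      by (simp add: G1_def P_def)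
    have verts1: "pverts G1 = insert w (pverts G)" by (simp add: G1_def)
    have P_w: "a \<noteq> w" "b \<noteq> w" if "(a, b) \<in> P" for a b
      using that w G.wellformed' by (auto simp: P_def)
    have len1_P: "len1 (a, b) = len (a, b)" if "(a, b) \<in> P" for a b
      using P_w[OF that] by (simp add: len1_def)
    have len1_w: "len1 (u, w) = 1" "len1 (w, u) = 1" "len1 (w, v) = m - 1" "len1 (v, w) = m - 1"
      using wuv vu(2) by (auto simp: len1_def)
    interpret G1: pair_graph G1
      unfolding G1_def using uv(1) w by (rule G.pair_graph_subdivide)
    have finP: "finite P" by (simp add: P_def)
    have "(\<Sum>e\<in>parcs G1. len1 e - 1) = (\<Sum>e\<in>P. len1 e - 1) + (\<Sum>e\<in>{(u, w), (w, u), (w, v), (v, w)}. len1 e - 1)"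
      unfolding arcs1 using finP P_w by (intro sum.union_disjoint) auto
    also have "(\<Sum>e\<in>P. len1 e - 1) = (\<Sum>e\<in>P. len e - 1)"
      using len1_P by (intro sum.cong) auto
    also have "(\<Sum>e\<in>{(u, w), (w, u), (w, v), (v, w)}. len1 e - 1) = 2 * (m - 2)"
      using wuv vu(2) by (simp add: len1_w)
    also have "(\<Sum>e\<in>P. len e - 1) + 2 * (m - 2) < (\<Sum>e\<in>P. len e - 1) + (\<Sum>e\<in>{(u, v), (v, u)}. len e - 1)"
      using m vu(2) by simp
    also have "\<dots> = (\<Sum>e\<in>P \<union> {(u, v), (v, u)}. len e - 1)"
      using finP by (intro sum.union_disjoint[symmetric]) (auto simp: P_def)
    also have "P \<union> {(u, v), (v, u)} = parcs G" using uv(1) vu(1) by (auto simp: P_def)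
    finally have smaller: "(\<Sum>e\<in>parcs G1. len1 e - 1) < (\<Sum>e\<in>parcs G. len e - 1)" .
    have len1_pos: "0 < len1 (a, b) \<and> len1 (a, b) = len1 (b, a)" if "(a, b) \<in> parcs G1" for a b
    proof (cases "(a, b) \<in> P")
      case True
      then have "(b, a) \<in> P" using G.arcs_symmetric by (auto simp: P_def)
      then show ?thesis using True len[of a b] len1_P by (auto simp: P_def)
    next
      case False
      then show ?thesis using that m len1_w by (auto simp: arcs1)
    qed
    obtain G' where G': "subdivision_pair G1 G'" "pair_graph G'" "pverts G1 \<subseteq> pverts G'"
      and up: "\<And>a b. (a, b) \<in> parcs G1 \<Longrightarrow> walk_le (parcs G') (pverts G') (len1 (a, b)) a b"
      and low: "\<And>\<phi> :: nat \<Rightarrow> int. (\<forall>a b. (a, b) \<in> parcs G1 \<longrightarrow> \<bar>\<phi> a - \<phi> b\<bar> \<le> int (len1 (a, b))) \<Longrightarrow>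
        (\<exists>\<psi>. (\<forall>x\<in>pverts G1. \<psi> x = \<phi> x) \<and> (\<forall>a b. (a, b) \<in> parcs G' \<longrightarrow> \<bar>\<psi> a - \<psi> b\<bar> \<le> 1))"
      using less.hyps[OF smaller G1.pair_graph len1_pos] by blast
    have "subdivision_pair G G1"
      unfolding G1_def by (rule subdivision_pair_divide[OF uv(1) w base])
    then have sub: "subdivision_pair G G'" using G'(1) by (rule subdivision_trans)
    have walk: "walk_le (parcs G') (pverts G') (len (a, b)) a b" if ab: "(a, b) \<in> parcs G" for a b
    proof -
      consider "(a, b) \<in> P" | "a = u" "b = v" | "a = v" "b = u" using ab by (auto simp: P_def)
      then show ?thesis
      proof cases
        case 1
        then show ?thesis using up[of a b] len1_P by (simp add: arcs1)
      next
        case 2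
        then show ?thesis
          using walk_le_trans[OF up[of u w] up[of w v]] m by (simp add: arcs1 len1_w)
      next
        case 3
        then show ?thesis
          using walk_le_trans[OF up[of v w] up[of w u]] m by (simp add: arcs1 len1_w)
      qed
    qed
    have ext: "\<exists>\<psi>. (\<forall>x\<in>pverts G. \<psi> x = \<phi> x) \<and> (\<forall>a b. (a, b) \<in> parcs G' \<longrightarrow> \<bar>\<psi> a - \<psi> b\<bar> \<le> 1)"
      if \<phi>: "\<forall>a b. (a, b) \<in> parcs G \<longrightarrow> \<bar>\<phi> a - \<phi> b\<bar> \<le> int (len (a, b))" for \<phi> :: "nat \<Rightarrow> int"
    proof -
      \<comment> \<open>One unit of the way from \<open>\<phi> u\<close> towards
        \<open>\<phi> v\<close> is spent on the unit edge, so at most \<open>m - 1\<close> remains.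
        If the end values agree, \<open>sgn\<close> is 0 and \<open>w\<close> takes the same
        value.\<close>
      define \<phi>1 where "\<phi>1 = \<phi>(w := \<phi> u + sgn (\<phi> v - \<phi> u))"
      have "\<bar>\<phi> u - \<phi> v\<bar> \<le> int m" using \<phi> uv(1) m by auto
      then have "\<bar>\<phi>1 u - \<phi>1 w\<bar> \<le> 1" "\<bar>\<phi>1 w - \<phi>1 v\<bar> \<le> int (m - 1)"
        using wuv m by (auto simp: \<phi>1_def sgn_if)
      moreover have "\<bar>\<phi>1 a - \<phi>1 b\<bar> \<le> int (len (a, b))" if "(a, b) \<in> P" for a b
        using P_w[OF that] \<phi> that by (auto simp: \<phi>1_def P_def)
      ultimately have "\<forall>a b. (a, b) \<in> parcs G1 \<longrightarrow> \<bar>\<phi>1 a - \<phi>1 b\<bar> \<le> int (len1 (a, b))"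
        by (auto simp: arcs1 len1_w len1_P abs_minus_commute)
      from low[OF this] obtain \<psi> where
        "\<forall>x\<in>pverts G1. \<psi> x = \<phi>1 x" "\<forall>a b. (a, b) \<in> parcs G' \<longrightarrow> \<bar>\<psi> a - \<psi> b\<bar> \<le> 1" by blast
      moreover have "\<phi>1 x = \<phi> x" if "x \<in> pverts G" for x using that w by (auto simp: \<phi>1_def)
      ultimately show ?thesis by (auto simp: verts1)
    qed
    show ?thesis
      using sub G'(2,3) walk ext by (intro exI[of _ G']) (auto simp: verts1)
  qed
qed

text \<open>Upper bound: three legs of length \<open>L\<close>, one inside each branch set and one
  between them. Lower bound: \<open>L\<close> times the \<open>j\<close>-th coordinate of the branch
  set changes along each edge by at most its length, so it extends to \<open>G'\<close> and
  separates opposite faces by \<open>L * p\<close>.\<close>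

lemma king_grid_model_subdivision:
  fixes G :: "nat pair_pre_digraph" and B :: "(nat \<Rightarrow> nat) \<Rightarrow> nat set"
  assumes G: "pair_graph G" and L: "L = card (pverts G)" "0 < L" and p: "0 < p"
    and B: "\<And>x. x \<in> grid d p \<Longrightarrow> B x \<subseteq> pverts G"
      "\<And>x a b. x \<in> grid d p \<Longrightarrow> a \<in> B x \<Longrightarrow> b \<in> B x \<Longrightarrow> \<exists>n. walk_le (parcs G) (B x) n a b"
      "\<And>x y. x \<in> grid d p \<Longrightarrow> y \<in> grid d p \<Longrightarrow> x \<noteq> y \<Longrightarrow> B x \<inter> B y = {}"
      "\<And>x y. x \<in> grid d p \<Longrightarrow> y \<in> grid d p \<Longrightarrow> king x y \<Longrightarrow> x \<noteq> y \<Longrightarrow>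
        \<exists>u\<in>B x. \<exists>v\<in>B y. (u, v) \<in> parcs G"
    and rep: "\<And>x. x \<in> grid d p \<Longrightarrow> rep x \<in> B x"
  obtains G' where "subdivision_pair G G'" "pair_graph G'" "pverts G \<subseteq> pverts G'"
    "\<And>x y. x \<in> grid d p \<Longrightarrow> y \<in> grid d p \<Longrightarrow> king x y \<Longrightarrow>
      walk_le (parcs G') (pverts G') (3 * L) (rep x) (rep y)"
    "\<And>x y j m. x \<in> grid d p \<Longrightarrow> y \<in> grid d p \<Longrightarrow> j < d \<Longrightarrow> x j = 0 \<Longrightarrow> y j = p \<Longrightarrow>
      walk_le (parcs G') (pverts G') m (rep x) (rep y) \<Longrightarrow> L * p \<le> m"
proof -
  interpret G: pair_graph G by fact
  let ?gr = "grid d p"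
  have sym_G: "sym (parcs G)" using G.arcs_symmetric by (auto simp: sym_def)
  define in_cell where "in_cell a b \<longleftrightarrow> (\<exists>x\<in>?gr. a \<in> B x \<and> b \<in> B x)" for a b
  define near where "near a b \<longleftrightarrow> (\<exists>x\<in>?gr. \<exists>y\<in>?gr. king x y \<and> a \<in> B x \<and> b \<in> B y)" for a b
  define len where "len = (\<lambda>(a, b). if in_cell a b then 1 else if near a b then L else L * p)"
  have "in_cell a b = in_cell b a" "near a b = near b a" for a b
    by (auto simp: in_cell_def near_def intro: king_sym)
  then have len: "0 < len (a, b) \<and> len (a, b) = len (b, a)" for a b
    using L(2) p by (simp add: len_def)
  obtain G' where G': "subdivision_pair G G'" "pair_graph G'" "pverts G \<subseteq> pverts G'"
    and up: "\<And>a b. (a, b) \<in> parcs G \<Longrightarrow> walk_le (parcs G') (pverts G') (len (a, b)) a b"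
    and low: "\<And>\<phi> :: nat \<Rightarrow> int. (\<forall>a b. (a, b) \<in> parcs G \<longrightarrow> \<bar>\<phi> a - \<phi> b\<bar> \<le> int (len (a, b))) \<Longrightarrow>
      (\<exists>\<psi>. (\<forall>x\<in>pverts G. \<psi> x = \<phi> x) \<and> (\<forall>a b. (a, b) \<in> parcs G' \<longrightarrow> \<bar>\<psi> a - \<psi> b\<bar> \<le> 1))"
    using weighted_subdivision[of G len, OF G len] by blast
  have inner: "walk_le (parcs G') (pverts G') L a b" if x: "x \<in> ?gr" "a \<in> B x" "b \<in> B x" for x a b
  proof -
    obtain n where "walk_le (parcs G) (B x) n a b" using B(2)[OF x] by blast
    from walk_le_card[OF sym_G finite_subset[OF B(1)[OF x(1)] G.finite_verts] this]
    have "walk_le (parcs G) (B x) (card (B x)) a b" .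
    then have "walk_le (parcs G') (pverts G') (card (B x)) a b"
    proof (rule walk_le_transfer)
      show "B x \<subseteq> pverts G'" using B(1)[OF x(1)] G'(3) by blast
      fix u v assume "(u, v) \<in> parcs G" "u \<in> B x" "v \<in> B x"
      moreover from this have "len (u, v) = 1" using x(1) by (auto simp: len_def in_cell_def)
      ultimately show "walk_le (parcs G') (pverts G') 1 u v" using up[of u v] by simp
    qed
    then show ?thesis
      by (rule walk_le_mono_length) (use card_mono[OF G.finite_verts B(1)[OF x(1)]] L(1) in simp)
  qed
  have upper: "walk_le (parcs G') (pverts G') (3 * L) (rep x) (rep y)"
    if xy: "x \<in> ?gr" "y \<in> ?gr" "king x y" for x y
  proof (cases "x = y")
    case True
    then show ?thesis
      using inner[OF xy(1) rep[OF xy(1)] rep[OF xy(1)]] by (auto intro: walk_le_mono_length)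
  next
    case False
    then obtain u v where uv: "u \<in> B x" "v \<in> B y" "(u, v) \<in> parcs G" using B(4) xy by blast
    have "len (u, v) \<le> L" using uv xy L(2) by (auto simp: len_def near_def)
    from walk_le_mono_length[OF up[OF uv(3)] this]
    have "walk_le (parcs G') (pverts G') L u v" .
    from walk_le_trans[OF walk_le_trans[OF inner[OF xy(1) rep[OF xy(1)] uv(1)] this]
        inner[OF xy(2) uv(2) rep[OF xy(2)]]]
    show ?thesis by (simp add: numeral_3_eq_3 add.assoc)
  qed
  have lower: "L * p \<le> m"
    if xy: "x \<in> ?gr" "y \<in> ?gr" "j < d" "x j = 0" "y j = p"
      and walk: "walk_le (parcs G') (pverts G') m (rep x) (rep y)" for x y j m
  proof -
    \<comment> \<open>Disjointness of the branch sets makes this choice unique on their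
      union.\<close>
    define cell where "cell a = (SOME z. z \<in> ?gr \<and> a \<in> B z)" for a
    have cell: "cell a = z" if "z \<in> ?gr" "a \<in> B z" for a z
    proof -
      have "cell a \<in> ?gr \<and> a \<in> B (cell a)" 
        unfolding cell_def by (rule someI[of "\<lambda>z. z \<in> ?gr \<and> a \<in> B z" z]) (use that in simp)
      with B(3)[of "cell a" z] that show ?thesis by auto
    qed
    \<comment> \<open>The value 0 off the branch sets does no harm: edges ending there have length
      \<open>L * p\<close>, the whole range of \<open>\<phi>\<close>.\<close>
    define \<phi> :: "nat \<Rightarrow> int" where "\<phi> a = (if a \<in> (\<Union>z\<in>?gr. B z) then int L * int (cell a j) else 0)" for a
    have \<phi>_cell: "\<phi> a = int L * int (z j)" if "z \<in> ?gr" "a \<in> B z" for a z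
      using cell[OF that] that by (auto simp: \<phi>_def)
    have \<phi>_bd: "0 \<le> \<phi> a \<and> \<phi> a \<le> int (L * p)" for a
    proof (cases "a \<in> (\<Union>z\<in>?gr. B z)")
      case True
      then obtain z where z: "z \<in> ?gr" "a \<in> B z" by blast
      have "z j \<le> p" using z(1) xy(3) by (simp add: grid_def)
      then show ?thesis using \<phi>_cell[OF z] by (simp add: mult_left_mono)
    qed (simp add: \<phi>_def)
    have lipschitz: "\<bar>\<phi> a - \<phi> b\<bar> \<le> int (len (a, b))" for a b
    proof -
      consider (cell) "in_cell a b" | (near) "\<not> in_cell a b" "near a b" | (far) "\<not> in_cell a b" "\<not> near a b"
        by blast
      then show ?thesis
      proof cases
        case cell
        then show ?thesis using \<phi>_cell by (auto simp: in_cell_def)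
      next
        case near
        then obtain z z' where z: "z \<in> ?gr" "z' \<in> ?gr" "king z z'" "a \<in> B z" "b \<in> B z'"
          by (auto simp: near_def)
        have "\<bar>int (z j) - int (z' j)\<bar> \<le> 1" using z(3) by (auto simp: king_def abs_le_iff dest!: spec[of _ j])
        then have "int L * \<bar>int (z j) - int (z' j)\<bar> \<le> int L * 1" by (intro mult_left_mono) auto
        moreover have "\<phi> a - \<phi> b = int L * (int (z j) - int (z' j))"
          using \<phi>_cell z by (simp add: right_diff_distrib)
        ultimately show ?thesis using near by (simp add: len_def abs_mult)
      next
        case far
        then show ?thesis using \<phi>_bd[of a] \<phi>_bd[of b] by (auto simp: len_def)
      qed
    qed
    have "\<forall>a b. (a, b) \<in> parcs G \<longrightarrow> \<bar>\<phi> a - \<phi> b\<bar> \<le> int (len (a, b))"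
      using lipschitz by (intro allI impI)
    from low[OF this] obtain \<psi> where \<psi>: "\<forall>x\<in>pverts G. \<psi> x = \<phi> x"
      "\<And>a b. (a, b) \<in> parcs G' \<Longrightarrow> \<bar>\<psi> a - \<psi> b\<bar> \<le> 1" by blast
    have "\<psi> (rep x) = 0" "\<psi> (rep y) = int (L * p)"
      using \<psi>(1) \<phi>_cell[OF xy(1) rep[OF xy(1)]] \<phi>_cell[OF xy(2) rep[OF xy(2)]] xy(4,5)
        B(1)[OF xy(1)] B(1)[OF xy(2)] rep[OF xy(1)] rep[OF xy(2)] by (auto simp: subset_iff)
    then have "int (L * p) \<le> int m" using walk_le_lipschitz[of _ _ m _ _ \<psi>, OF walk \<psi>(2)] by simp
    then show ?thesis by (simp only: of_nat_le_iff)
  qed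
  show ?thesis by (rule that[OF G' upper lower])
qed

section \<open>From a linear control function to an excluded king grid\<close>

text \<open>The scale \<open>L\<close> depends on \<open>G\<close>, but both the distance
  \<open>L * p\<close> and the bound \<open>c * (3 * L)\<close> are proportional to it. Hence one
  grid \<open>H\<close> serves the whole class.\<close>

lemma control_function_imp_minor_free:
  fixes \<G> :: "nat pair_pre_digraph set"
  assumes graphs: "graph_class \<G>" and closed: "subdivision_closed \<G>"
    and f: "class_control_function n f \<G>" and c: "\<And>r. 0 < r \<Longrightarrow> f r \<le> c * r"
  shows "\<exists>H :: nat pair_pre_digraph. pair_graph H \<and> (\<forall>G\<in>\<G>. minor_free H G)"
proof -
  define p where "p = Suc (nat \<lceil>3 * c\<rceil>)"
  have p: "0 < p" "3 * c < real p" by (simp_all add: p_def) linarith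
  let ?gr = "grid (Suc n) p"
  \<comment> \<open>Grid points are functions, whereas \<open>H\<close> must have natural numbers as
    vertices.\<close>
  obtain g :: "(nat \<Rightarrow> nat) \<Rightarrow> nat" where g: "inj_on g ?gr"
    using finite_imp_inj_to_nat_seg[OF finite_grid] by blast
  define H where "H = \<lparr>pverts = g ` ?gr,
    parcs = {(g x, g y) | x y. x \<in> ?gr \<and> y \<in> ?gr \<and> king x y \<and> x \<noteq> y}\<rparr>"
  have "pair_graph H"
  proof
    have "parcs H \<subseteq> pverts H \<times> pverts H" by (auto simp: H_def)
    then show "finite (parcs H)" by (rule finite_subset) (simp add: H_def finite_grid)
    show "symmetric (with_proj H)"
      unfolding symmetric_def sym_def by (auto simp: H_def intro: king_sym)
  qed (auto simp: H_def finite_grid inj_on_eq_iff[OF g])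
  moreover have "minor_free H G" if G_in: "G \<in> \<G>" for G
    unfolding minor_free_def
  proof
    assume "is_minor H G"
    then obtain B where model: "(\<forall>x\<in>pverts H. B x \<subseteq> pverts G \<and>
          Digraph_Component.connected (induce_subgraph (with_proj G) (B x))) \<and>
        (\<forall>x\<in>pverts H. \<forall>y\<in>pverts H. x \<noteq> y \<longrightarrow> B x \<inter> B y = {}) \<and>
        (\<forall>(x, y)\<in>parcs H. \<exists>u\<in>B x. \<exists>v\<in>B y. (u, v) \<in> parcs G)"
      unfolding is_minor_def by (rule exE)
    have B: "B x \<subseteq> pverts G" "Digraph_Component.connected (induce_subgraph (with_proj G) (B x))"
      if "x \<in> pverts H" for x
      using bspec[OF model[THEN conjunct1] that] by simp_all
    have B_disj: "B x \<inter> B y = {}" if "x \<in> pverts H" "y \<in> pverts H" "x \<noteq> y" for x y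
      using model[THEN conjunct2, THEN conjunct1] that by simp
    have B_adj: "\<exists>u\<in>B x. \<exists>v\<in>B y. (u, v) \<in> parcs G" if "(x, y) \<in> parcs H" for x y
      using bspec[OF model[THEN conjunct2, THEN conjunct2] that] by simp
    have G: "pair_graph G" using graphs G_in by (simp add: graph_class_def)
    then interpret G: pair_graph G .
    define D where "D x = B (g x)" for x
    have gH: "g x \<in> pverts H" if "x \<in> ?gr" for x using that by (simp add: H_def)
    have D: "D x \<subseteq> pverts G" "D x \<noteq> {}" "\<And>a b. a \<in> D x \<Longrightarrow> b \<in> D x \<Longrightarrow> \<exists>n. walk_le (parcs G) (D x) n a b"
      if "x \<in> ?gr" for x
      using B(1,2)[OF gH[OF that]] connected_induce_iff[OF G] by (auto simp: D_def)
    have D_disj: "D x \<inter> D y = {}" if "x \<in> ?gr" "y \<in> ?gr" "x \<noteq> y" for x y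
      unfolding D_def using that inj_on_eq_iff[OF g] by (intro B_disj gH) simp_all
    have D_adj: "\<exists>u\<in>D x. \<exists>v\<in>D y. (u, v) \<in> parcs G"
      if "x \<in> ?gr" "y \<in> ?gr" "king x y" "x \<noteq> y" for x y
      unfolding D_def using that by (intro B_adj) (auto simp: H_def)
    define rep where "rep x = (SOME a. a \<in> D x)" for x
    have rep: "rep x \<in> D x" if "x \<in> ?gr" for x
      unfolding rep_def using D(2)[OF that] by (simp add: some_in_eq)
    define L where "L = card (pverts G)"
    have top: "(\<lambda>_. p) \<in> ?gr" by (simp add: grid_def)
    have "pverts G \<noteq> {}" using rep[OF top] D(1)[OF top] by blast
    then have L: "0 < L" by (simp add: L_def card_gt_0_iff)
    obtain G' where G': "subdivision_pair G G'" "pair_graph G'" "pverts G \<subseteq> pverts G'"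
      and upper: "\<And>x y. x \<in> ?gr \<Longrightarrow> y \<in> ?gr \<Longrightarrow> king x y \<Longrightarrow>
        walk_le (parcs G') (pverts G') (3 * L) (rep x) (rep y)"
      and lower: "\<And>x y j m. x \<in> ?gr \<Longrightarrow> y \<in> ?gr \<Longrightarrow> j < Suc n \<Longrightarrow> x j = 0 \<Longrightarrow> y j = p \<Longrightarrow>
        walk_le (parcs G') (pverts G') m (rep x) (rep y) \<Longrightarrow> L * p \<le> m"
    proof -
      show thesis
        by (rule king_grid_model_subdivision[where B = D and rep = rep and d = "Suc n",
            OF G L_def L p(1)]) (fact D(1) D(3) D_disj D_adj rep that)+
    qed
    \<comment> \<open>At this scale representatives of king-adjacent grid points may be consecutive
      on an \<open>r\<close>-path.\<close>
    define r where "r = real (3 * L)"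
    have r: "0 < r" using L by (simp add: r_def)
    have "G' \<in> \<G>" using closed G_in G'(1) by (auto simp: subdivision_closed_def)
    then have "control_function n f G'" using f by (simp add: class_control_function_def)
    then obtain C :: "nat set" and col where col: "is_colouring G' (n + 1) r (f r) C col"
      using r unfolding control_function_def by blast
    have repV: "rep x \<in> pverts G'" if "x \<in> ?gr" for x
      using rep[OF that] D(1)[OF that] G'(3) by blast
    define S where "S = {(x, y). x \<in> ?gr \<and> y \<in> ?gr \<and> king x y \<and> (col \<circ> rep) x = (col \<circ> rep) y}"
    have C: "finite C" "card C = Suc n" and "(col \<circ> rep) ` ?gr \<subseteq> C"
      using col repV by (auto simp: is_colouring_def)
    from monochromatic_crossing[OF p(1) this, folded S_def]
    obtain j x y where j: "j < Suc n" and xy: "x \<in> ?gr" "y \<in> ?gr" "(x, y) \<in> S\<^sup>*" "x j = 0" "y j = p"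
      by blast
    obtain q where q: "q \<noteq> []" "x \<in> set q" "y \<in> set q" "successively (\<lambda>a b. (a, b) \<in> S) q"
      "\<forall>z\<in>set q. (x, z) \<in> S\<^sup>*"
      using rtrancl_imp_chain[OF xy(3)] by blast
    have S_inv: "z \<in> ?gr \<and> col (rep z) = col (rep x)" if "(x, z) \<in> S\<^sup>*" for z
      using that by induction (auto simp: S_def xy(1))
    have q_gr: "z \<in> ?gr" "col (rep z) = col (rep x)" if "z \<in> set q" for z
      using S_inv[OF bspec[OF q(5) that]] by simp_all
    have "r_path G' r (map rep q)"
      unfolding r_path_def
    proof (intro conjI)
      show "set (map rep q) \<subseteq> pverts G'" using repV[OF q_gr(1)] by auto
      have "successively (\<lambda>a b. graph_dist G' (rep a) (rep b) \<le> ereal r) q"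
        using q(4)
      proof (rule successively_mono)
        fix a b assume "(a, b) \<in> S"
        then have a: "a \<in> ?gr" and w: "walk_le (parcs G') (pverts G') (3 * L) (rep a) (rep b)"
          using upper by (auto simp: S_def)
        show "graph_dist G' (rep a) (rep b) \<le> ereal r"
          unfolding graph_dist_le_iff[OF G'(2) repV[OF a] less_imp_le[OF r]]
          unfolding r_def floor_of_nat nat_int by (rule w)
      qed
      then show "successively (\<lambda>u v. graph_dist G' u v \<le> ereal r) (map rep q)"
        by (simp add: successively_map)
    qed (use q in simp)
    moreover have "\<forall>v\<in>set (map rep q). col v = col (rep x)" using q_gr(2) by auto
    ultimately have "weak_diam G' (set (map rep q)) \<le> ereal (f r)"
      using col unfolding is_colouring_def by blast
    moreover have "graph_dist G' (rep x) (rep y) \<le> weak_diam G' (set (map rep q))"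
    proof -
      have "rep x \<in> set (map rep q)" "rep y \<in> set (map rep q)" using q(2,3) by auto
      then have "graph_dist G' (rep x) (rep y) \<le> (SUP v\<in>set (map rep q). graph_dist G' (rep x) v)"
        by (intro SUP_upper)
      also have "\<dots> \<le> weak_diam G' (set (map rep q))"
        unfolding weak_diam_def by (rule SUP_upper) fact
      finally show ?thesis .
    qed
    ultimately have "graph_dist G' (rep x) (rep y) \<le> ereal (f r)" by (rule order_trans[rotated])
    moreover have "0 < f r" using f r by (simp add: class_control_function_def)
    ultimately have "walk_le (parcs G') (pverts G') (nat \<lfloor>f r\<rfloor>) (rep x) (rep y)"
      using graph_dist_le_iff[OF G'(2) repV[OF xy(1)]] by simp
    then have "L * p \<le> nat \<lfloor>f r\<rfloor>" by (rule lower[OF xy(1,2) j xy(4,5)])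
    then have "real (L * p) \<le> real (nat \<lfloor>f r\<rfloor>)" by (simp only: of_nat_le_iff)
    also have "\<dots> \<le> f r" using \<open>0 < f r\<close> by simp
    finally have "real (L * p) \<le> f r" .
    also have "\<dots> \<le> c * r" by (rule c[OF r])
    also have "\<dots> = real L * (3 * c)" by (simp add: r_def)
    also have "\<dots> < real L * real p" using p(2) L by (intro mult_strict_left_mono) auto
    finally show False by simp
  qed
  ultimately show ?thesis by blast
qed

subsection \<open>The characterisation\<close>

lemma assouad_nagata_dim_finite_iff:
  "assouad_nagata_dim \<G> < \<infinity> \<longleftrightarrow> (\<exists>n f. class_control_function n f \<G> \<and> dilation f)"
proof
  assume finite: "assouad_nagata_dim \<G> < \<infinity>"
  have "{enat n | n. \<exists>f. class_control_function n f \<G> \<and> dilation f} \<noteq> {}"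
  proof
    assume "{enat n | n. \<exists>f. class_control_function n f \<G> \<and> dilation f} = {}"
    then show False using finite by (simp only: assouad_nagata_dim_def) (simp add: top_enat_def)
  qed
  then show "\<exists>n f. class_control_function n f \<G> \<and> dilation f" by blast
next
  assume "\<exists>n f. class_control_function n f \<G> \<and> dilation f"
  then obtain n where "assouad_nagata_dim \<G> \<le> enat n"
    unfolding assouad_nagata_dim_def by (blast intro: Inf_lower)
  then show "assouad_nagata_dim \<G> < \<infinity>" by (rule le_less_trans) simp
qed

theorem theorem4:
  fixes \<G> :: "nat pair_pre_digraph set"
  assumes "graph_class \<G>"
    and "subdivision_closed \<G>"
  shows "assouad_nagata_dim \<G> < \<infinity> \<longleftrightarrow>
    (\<exists>H :: nat pair_pre_digraph. pair_graph H \<and> (\<forall>G\<in>\<G>. minor_free H G))"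
  unfolding assouad_nagata_dim_finite_iff
proof
  assume "\<exists>n f. class_control_function n f \<G> \<and> dilation f"
  then obtain n f c where "class_control_function n f \<G>" "\<And>r. 0 < r \<Longrightarrow> f r \<le> c * r"
    by (auto simp: dilation_def)
  from control_function_imp_minor_free[OF assms this]
  show "\<exists>H :: nat pair_pre_digraph. pair_graph H \<and> (\<forall>G\<in>\<G>. minor_free H G)" .
next
  assume "\<exists>H :: nat pair_pre_digraph. pair_graph H \<and> (\<forall>G\<in>\<G>. minor_free H G)"
  then obtain H :: "nat pair_pre_digraph" where H: "pair_graph H" "\<And>G. G \<in> \<G> \<Longrightarrow> minor_free H G"
    by blast
  define t where "t = card (pverts H) + 2"
  define K where "K = real (t * (6 * 2 ^ t))"
  have K: "0 < K" unfolding K_def t_def of_nat_0_less_iff by simp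
  \<comment> \<open>Dimension \<open>n\<close> allows \<open>n + 1\<close> colours, so
    \<open>2 ^ t\<close> colours give dimension \<open>2 ^ t - 1\<close>.\<close>
  have "control_function (2 ^ t - 1) (\<lambda>r. K * r) G" if "G \<in> \<G>" for G
    using minor_free_imp_colouring[OF _ H(1) H(2)[OF that] _ t_def] assms(1) that K
    by (simp add: control_function_def graph_class_def K_def)
  then have "class_control_function (2 ^ t - 1) (\<lambda>r. K * r) \<G>"
    using K by (simp add: class_control_function_def)
  moreover have "dilation (\<lambda>r. K * r)" using K by (auto simp: dilation_def)
  ultimately show "\<exists>n f. class_control_function n f \<G> \<and> dilation f" by blast
qed

end
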